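(* Let $(v,f,p)$ be a (nontrivial) axisymmetric $C^1$-solution with parameter $\alpha\in\mathbb{R}$ and with $p$ constant on $\mathbb{S}^2$. Then the solution is geodesic, and it is given by one of the following. (1) A member of the following family: $\alpha p=0$ and there are real numbers $a_0,b_0$ with $a_0^2+b_0^2=1$ such that, up to multiplication of $V$ by a constant and with the $z$-axis as the axis of symmetry, $V=\langle V^x,V^y,V^z\rangle$ is given by $$V^x=b_0^2\frac{xz}{x^2+y^2}K^{-\frac{\alpha}{2}}+b_0\frac{y}{x^2+y^2}K^{\frac{1-\alpha}{2}},\qquad V^y=b_0^2\frac{yz}{x^2+y^2}K^{-\frac{\alpha}{2}}-b_0\frac{x}{x^2+y^2}K^{\frac{1-\alpha}{2}},\qquad V^z=a_0^2K^{-\frac{\alpha}{2}},$$ where $$K=\begin{cases}a_0^2(x^2+y^2)-b_0^2z^2, & b_0^2z^2\le a_0^2(x^2+y^2),\\ 0,& b_0^2z^2>a_0^2(x^2+y^2).\end{cases}$$ In this case $\alpha\le-2$ with swirl ($b_0\ne0$), and $\alpha\le-1$ without swirl ($b_0=0$). (2) The radial solution, in the case $\alpha=2$: $v=0$, $f$ is constant and $p=-\frac12f^2$.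
   Context: $\mathbb{S}^2$ is the unit sphere in $\mathbb{R}^3$ with outward unit normal $\vec n$. A $C^k$-solution with parameter $\alpha$ is a triple $(v,f,p)$, where $v$ is a tangent vector field and $f,p$ are functions on $\mathbb{S}^2$, all of class $C^k$ ($k\ge1$), such that $$V(X)=\frac{v+f\vec n}{|X|^{\alpha}},\qquad P(X)=\frac{p}{|X|^{2\alpha}}$$ ($v,f,p,\vec n$ evaluated at $X/|X|$) solve the stationary Euler system $V\cdot\nabla V+\nabla P=0$, $\operatorname{div}V=0$ in $\mathbb{R}^3\setminus\{0\}$. Equivalently, on $\mathbb{S}^2$, $$(2-\alpha)f+\operatorname{div}v=0,\quad v\nabla f=|v|^2+\alpha f^2+2\alpha p,\quad (1-\alpha)fv+v\nabla v=-\nabla p,$$ where $v\nabla f=\langle v,\nabla f\rangle$ and $v\nabla v$ is the covariant derivative. Spherical coordinates on $\mathbb{S}^2$ are $x=\sin\phi\cos\theta$, $y=\sin\phi\sin\theta$, $z=\cos\phi$, with orthonormal frame $\vec e_\phi,\vec e_\theta$, and $v=a\,\vec e_\phi+b\,\vec e_\theta$. The solution is axisymmetric if, in some such coordinate system, $a,b,f,p$ depend only on $\phi$; $b$ is the swirl. A solution is geodesic if its flow trajectories are straight lines (or rays), expressed by $(V\cdot\nabla V)\times V=0$. The formulas for $V$ in (1) are understood for $x^2+y^2>0$ and extended by continuity to the rest of $\mathbb{R}^3\setminus\{0\}$.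
   Formalization: Without swirl (b_0=0) the bound α≤-1 is replaced by "α≤-1 or α=0", since the uniform flow V=(0,0,1) with p=0 is a nonzero axisymmetric solution in family (1) with α=0; "nontrivial" is read as V not identically zero. *)

theory Defs
  imports "HOL-Analysis.Analysis"
begin

unbundle cross3_syntax

text \<open>Stationary Euler equations in open subsets of three-space, classical sense.\<close>

definition convective :: "(real^3 \<Rightarrow> real^3) \<Rightarrow> real^3 \<Rightarrow> real^3" where
  "convective V X = frechet_derivative V (at X) (V X)"

definition gradient :: "(real^3 \<Rightarrow> real) \<Rightarrow> real^3 \<Rightarrow> real^3" where
  "gradient P X = (\<chi> i. frechet_derivative P (at X) (axis i 1))"

definition divergence :: "(real^3 \<Rightarrow> real^3) \<Rightarrow> real^3 \<Rightarrow> real" where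
  "divergence V X = trace (jacobian V (at X))"

definition stationary_Euler_on ::
    "(real^3) set \<Rightarrow> (real^3 \<Rightarrow> real^3) \<Rightarrow> (real^3 \<Rightarrow> real) \<Rightarrow> bool" where
  "stationary_Euler_on D V P \<longleftrightarrow>
     (\<forall>X\<in>D. V differentiable (at X) \<and> P differentiable (at X) \<and>
        convective V X + gradient P X = 0 \<and> divergence V X = 0)"

text \<open>
  Pointwise continuity of the derivative in each direction is the same as continuity in the
  operator norm, the domain being finite-dimensional. Class \<open>C\<^sup>1\<close> on an embedded
  surface \<open>M\<close> means: locally the restriction of a \<open>C\<^sup>1\<close> function on an open set of
  the ambient space.
\<close>

definition C1_on_open ::
    "('a::euclidean_space) set \<Rightarrow> ('a \<Rightarrow> 'b::real_normed_vector) \<Rightarrow> bool" where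
  "C1_on_open U g \<longleftrightarrow> open U \<and> g differentiable_on U \<and>
     (\<forall>h. continuous_on U (\<lambda>x. frechet_derivative g (at x) h))"

definition C1_on_surface ::
    "('a::euclidean_space) set \<Rightarrow> ('a \<Rightarrow> 'b::real_normed_vector) \<Rightarrow> bool" where
  "C1_on_surface M g \<longleftrightarrow>
     (\<forall>x\<in>M. \<exists>U G. x \<in> U \<and> C1_on_open U G \<and> (\<forall>y\<in>U \<inter> M. G y = g y))"

lemma C1_on_surfaceI:
  fixes g :: "'a::euclidean_space \<Rightarrow> 'b::real_normed_vector"
  assumes d: "\<And>x. (g has_derivative g' x) (at x)" and c: "\<And>h. continuous_on UNIV (\<lambda>x. g' x h)"
  shows "C1_on_surface M g"
proof -
  have "frechet_derivative g (at x) = g' x" for x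
    using frechet_derivative_at[OF d] by simp
  then have "C1_on_open UNIV g"
    using c d unfolding C1_on_open_def differentiable_on_def differentiable_def by auto
  then show ?thesis unfolding C1_on_surface_def by blast
qed

text \<open>
  \<open>sgn X\<close> is \<open>X / |X|\<close>, which is also the outward unit normal at that point of the sphere.
  Only the values of \<open>v\<close>, \<open>f\<close>, \<open>p\<close> on the unit sphere matter below.
\<close>

definition hom_velocity ::
    "real \<Rightarrow> (real^3 \<Rightarrow> real^3) \<Rightarrow> (real^3 \<Rightarrow> real) \<Rightarrow> real^3 \<Rightarrow> real^3" where
  "hom_velocity \<alpha> v f X = (v (sgn X) + f (sgn X) *\<^sub>R sgn X) /\<^sub>R (norm X powr \<alpha>)"

definition hom_pressure :: "real \<Rightarrow> (real^3 \<Rightarrow> real) \<Rightarrow> real^3 \<Rightarrow> real" where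
  "hom_pressure \<alpha> p X = p (sgn X) / norm X powr (2 * \<alpha>)"

definition C1_solution ::
    "real \<Rightarrow> (real^3 \<Rightarrow> real^3) \<Rightarrow> (real^3 \<Rightarrow> real) \<Rightarrow> (real^3 \<Rightarrow> real) \<Rightarrow> bool" where
  "C1_solution \<alpha> v f p \<longleftrightarrow>
     (\<forall>n\<in>sphere 0 1. v n \<bullet> n = 0) \<and>
     C1_on_surface (sphere 0 1) v \<and>
     C1_on_surface (sphere 0 1) f \<and>
     C1_on_surface (sphere 0 1) p \<and>
     stationary_Euler_on (- {0}) (hom_velocity \<alpha> v f) (hom_pressure \<alpha> p)"

definition nontrivial :: "(real^3 \<Rightarrow> real^3) \<Rightarrow> (real^3 \<Rightarrow> real) \<Rightarrow> bool" where
  "nontrivial v f \<longleftrightarrow> (\<exists>n\<in>sphere 0 1. v n \<noteq> 0 \<or> f n \<noteq> 0)"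

definition geodesic :: "real \<Rightarrow> (real^3 \<Rightarrow> real^3) \<Rightarrow> (real^3 \<Rightarrow> real) \<Rightarrow> bool" where
  "geodesic \<alpha> v f \<longleftrightarrow>
     (\<forall>X\<in>- {0}. convective (hom_velocity \<alpha> v f) X \<times> hom_velocity \<alpha> v f X = 0)"

definition sph :: "real \<Rightarrow> real \<Rightarrow> real^3" where
  "sph \<phi> \<theta> = vector [sin \<phi> * cos \<theta>, sin \<phi> * sin \<theta>, cos \<phi>]"

definition e_phi :: "real \<Rightarrow> real \<Rightarrow> real^3" where
  "e_phi \<phi> \<theta> = vector [cos \<phi> * cos \<theta>, cos \<phi> * sin \<theta>, - sin \<phi>]"

definition e_theta :: "real \<Rightarrow> real \<Rightarrow> real^3" where
  "e_theta \<phi> \<theta> = vector [- sin \<theta>, cos \<theta>, 0]"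

text \<open>
  Axisymmetry in the spherical coordinates whose Cartesian axes are the columns of the rotation
  \<open>R\<close>; the third column is the axis of symmetry. The poles, where the frame is undefined, are
  left out; there a continuous \<open>v\<close> of this form vanishes if it is tangent.
\<close>

definition axisymmetric_in ::
    "real^3^3 \<Rightarrow> (real^3 \<Rightarrow> real^3) \<Rightarrow> (real^3 \<Rightarrow> real) \<Rightarrow> (real^3 \<Rightarrow> real) \<Rightarrow> bool" where
  "axisymmetric_in R v f p \<longleftrightarrow>
     (\<exists>a b f\<^sub>0 p\<^sub>0 :: real \<Rightarrow> real. \<forall>\<phi>\<in>{0<..<pi}. \<forall>\<theta>.
        v (R *v sph \<phi> \<theta>) = a \<phi> *\<^sub>R (R *v e_phi \<phi> \<theta>) + b \<phi> *\<^sub>R (R *v e_theta \<phi> \<theta>) \<and>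
        f (R *v sph \<phi> \<theta>) = f\<^sub>0 \<phi> \<and>
        p (R *v sph \<phi> \<theta>) = p\<^sub>0 \<phi>)"

definition K :: "real \<Rightarrow> real \<Rightarrow> real^3 \<Rightarrow> real" where
  "K a\<^sub>0 b\<^sub>0 X =
     (let x = X$1; y = X$2; z = X$3 in
      if b\<^sub>0\<^sup>2 * z\<^sup>2 \<le> a\<^sub>0\<^sup>2 * (x\<^sup>2 + y\<^sup>2) then a\<^sub>0\<^sup>2 * (x\<^sup>2 + y\<^sup>2) - b\<^sub>0\<^sup>2 * z\<^sup>2 else 0)"

text \<open>
  Meaningful off the \<open>z\<close>-axis only. There \<open>0 powr t = 0\<close> agrees with the usual convention
  for \<open>t > 0\<close>; when \<open>b\<^sub>0 = 0\<close>, \<open>K\<close> is positive.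
\<close>

definition family_field :: "real \<Rightarrow> real \<Rightarrow> real \<Rightarrow> real^3 \<Rightarrow> real^3" where
  "family_field \<alpha> a\<^sub>0 b\<^sub>0 X =
     (let x = X$1; y = X$2; z = X$3; k = K a\<^sub>0 b\<^sub>0 X in
      vector
       [b\<^sub>0\<^sup>2 * (x * z / (x\<^sup>2 + y\<^sup>2)) * k powr (- \<alpha> / 2)
          + b\<^sub>0 * (y / (x\<^sup>2 + y\<^sup>2)) * k powr ((1 - \<alpha>) / 2),
        b\<^sub>0\<^sup>2 * (y * z / (x\<^sup>2 + y\<^sup>2)) * k powr (- \<alpha> / 2)
          - b\<^sub>0 * (x / (x\<^sup>2 + y\<^sup>2)) * k powr ((1 - \<alpha>) / 2),
        a\<^sub>0\<^sup>2 * k powr (- \<alpha> / 2)])"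

text \<open>
  \<open>V\<close> is a nonzero multiple \<open>c\<close> of the family member, in the Cartesian coordinates given by
  the columns of \<open>R\<close>. Continuity determines \<open>V\<close> on the axis of symmetry.
\<close>

definition is_family_member ::
    "real^3^3 \<Rightarrow> real \<Rightarrow> real \<Rightarrow> real \<Rightarrow> (real^3 \<Rightarrow> real^3) \<Rightarrow> bool" where
  "is_family_member R \<alpha> a\<^sub>0 b\<^sub>0 V \<longleftrightarrow>
     continuous_on (- {0}) V \<and>
     (\<exists>c. c \<noteq> 0 \<and> (\<forall>X. (X$1)\<^sup>2 + (X$2)\<^sup>2 > 0 \<longrightarrow>
        V (R *v X) = c *\<^sub>R (R *v family_field \<alpha> a\<^sub>0 b\<^sub>0 X)))"

text \<open>
  The uniform flow \<open>V = (0, 0, 1)\<close> with zero pressure is a swirl-free member of the family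
  with \<open>\<alpha> = 0\<close>, so that value cannot be excluded.
\<close>

lemma uniform_flow:
  fixes v :: "real^3 \<Rightarrow> real^3" and f p :: "real^3 \<Rightarrow> real"
  defines "v \<equiv> \<lambda>n. axis 3 1 - (n$3) *\<^sub>R n" and "f \<equiv> \<lambda>n. n$3" and "p \<equiv> \<lambda>n. 0"
  shows "C1_solution 0 v f p" and "nontrivial v f" and "axisymmetric_in (mat 1) v f p"
    and "is_family_member (mat 1) 0 1 0 (hom_velocity 0 v f)"
proof -
  have V: "hom_velocity 0 v f X = axis 3 1" if "X \<noteq> 0" for X
    using that by (simp add: hom_velocity_def v_def f_def)
  have P: "hom_pressure 0 p = (\<lambda>X. 0)"
    by (simp add: hom_pressure_def p_def fun_eq_iff)
  have dV: "(hom_velocity 0 v f has_derivative (\<lambda>h. 0)) (at X)" if "X \<noteq> 0" for X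
    by (rule has_derivative_transform_within_open[where s = "- {0}" and f = "\<lambda>X. axis 3 1"])
      (use that V in auto)
  have E: "stationary_Euler_on (- {0}) (hom_velocity 0 v f) (hom_pressure 0 p)"
    unfolding stationary_Euler_on_def P
  proof (intro ballI conjI)
    fix X :: "real^3" assume "X \<in> - {0}"
    then have d: "(hom_velocity 0 v f has_derivative (\<lambda>h. 0)) (at X)" using dV by simp
    have fd: "frechet_derivative (hom_velocity 0 v f) (at X) = (\<lambda>h. 0)"
      using frechet_derivative_at[OF d] by simp
    show "hom_velocity 0 v f differentiable (at X)" using d by (auto simp: differentiable_def)
    show "divergence (hom_velocity 0 v f) X = 0" by (simp add: divergence_def jacobian_def matrix_def trace_def fd)
    show "convective (hom_velocity 0 v f) X + gradient (\<lambda>X. 0) X = 0"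
      by (simp add: convective_def gradient_def fd vec_eq_iff)
  qed auto
  have nth: "((\<lambda>n::real^3. n$3) has_derivative (\<lambda>h. h$3)) (at x)" for x
    by (rule bounded_linear.has_derivative[OF bounded_linear_vec_nth has_derivative_ident])
  have "C1_on_surface (sphere 0 1) f"
    unfolding f_def by (rule C1_on_surfaceI[OF nth]) (intro continuous_intros)
  moreover have "C1_on_surface (sphere 0 1) v"
    unfolding v_def
    by (rule C1_on_surfaceI[where g' = "\<lambda>x h. - ((x$3) *\<^sub>R h + (h$3) *\<^sub>R x)"])
      (auto intro!: derivative_eq_intros nth continuous_intros)
  moreover have "C1_on_surface (sphere 0 1) p"
    unfolding p_def by (rule C1_on_surfaceI[where g' = "\<lambda>x h. 0"]) auto
  moreover have "v n \<bullet> n = 0" if "n \<in> sphere 0 1" for n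
    using that by (simp add: v_def inner_diff_left inner_axis' norm_eq_1)
  ultimately show "C1_solution 0 v f p" using E by (simp add: C1_solution_def)
  show "nontrivial v f" unfolding nontrivial_def f_def
    by (rule bexI[of _ "axis 3 1"]) auto
  show "axisymmetric_in (mat 1) v f p"
    unfolding axisymmetric_in_def
  proof (intro exI ballI allI conjI)
    fix \<phi> \<theta> :: real
    have s: "(cos \<phi>)\<^sup>2 = 1 - (sin \<phi>)\<^sup>2" by (rule cos_squared_eq)
    show "v (mat 1 *v sph \<phi> \<theta>) = (- sin \<phi>) *\<^sub>R (mat 1 *v e_phi \<phi> \<theta>)
        + 0 *\<^sub>R (mat 1 *v e_theta \<phi> \<theta>)"
      using s by (simp add: v_def sph_def e_phi_def vec_eq_iff forall_3 axis_def
        power2_eq_square algebra_simps)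
    show "f (mat 1 *v sph \<phi> \<theta>) = cos \<phi>" by (simp add: f_def sph_def)
    show "p (mat 1 *v sph \<phi> \<theta>) = 0" by (simp add: p_def)
  qed
  have "continuous_on (- {0}) (hom_velocity 0 v f)"
    using continuous_on_cong[OF refl, of "- {0}" "hom_velocity 0 v f" "\<lambda>_. axis 3 1"] V by simp
  moreover have "hom_velocity 0 v f (mat 1 *v X) = 1 *\<^sub>R (mat 1 *v family_field 0 1 0 X)"
    if "(X$1)\<^sup>2 + (X$2)\<^sup>2 > 0" for X
  proof -
    have "X \<noteq> 0" using that by auto
    then show ?thesis using that
      by (auto simp: V family_field_def K_def Let_def vec_eq_iff forall_3 axis_def)
  qed
  ultimately show "is_family_member (mat 1) 0 1 0 (hom_velocity 0 v f)"
    unfolding is_family_member_def by (metis zero_neq_one)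
qed

end

theory Submission
  imports Defs
begin

text \<open>
  On a meridian of the unit sphere write \<open>u\<close>, \<open>b\<close>, \<open>w\<close> for the radial, azimuthal and axial
  cylindrical components of \<open>V\<close>, and \<open>a = u cos - w sin\<close>, \<open>f = u sin + w cos\<close> for its
  spherical ones. The Euler system becomes an ODE system in the polar angle with the algebraic
  consequence \<open>a u = - b\<^sup>2 cos\<close>. Differentiating it where \<open>a \<noteq> 0\<close> gives \<open>\<alpha> p = 0\<close>.
  There \<open>w\<close>, \<open>b sin\<close> and \<open>a sin\<close> all satisfy \<open>a g' = m f g\<close>, with
  \<open>m = \<alpha>, \<alpha> - 1, \<alpha> - 2\<close>, so they are powers of the single function \<open>N = - a sin / w\<close>,
  and the algebraic relation forces \<open>N = sin\<^sup>2 - k\<^sup>2 cos\<^sup>2\<close>. Every component of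
  \<open>{a \<noteq> 0}\<close> is therefore a band around the equator, so there is only one; outside it the
  solution vanishes. Differentiability at the edge of the band, or at the poles when \<open>k = 0\<close>,
  restricts \<open>\<alpha>\<close>. If \<open>a\<close> vanishes identically, the solution is radial.
\<close>

section \<open>The equations on a meridian\<close>

text \<open>Here \<open>\<kappa>\<close> stands for \<open>2 \<alpha> p\<close>.\<close>

locale axisymmetric_profile =
  fixes \<alpha> \<kappa> :: real and u b w u' b' w' :: "real \<Rightarrow> real"
  assumes du: "\<And>t. t \<in> {0<..<pi} \<Longrightarrow> (u has_real_derivative u' t) (at t)"
    and db: "\<And>t. t \<in> {0<..<pi} \<Longrightarrow> (b has_real_derivative b' t) (at t)"
    and dw: "\<And>t. t \<in> {0<..<pi} \<Longrightarrow> (w has_real_derivative w' t) (at t)"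
    and momentum_u: "\<And>t. t \<in> {0<..<pi} \<Longrightarrow>
      (cos t * u t - sin t * w t) * u' t - (b t)\<^sup>2 / sin t
        - \<alpha> * (sin t * u t + cos t * w t) * u t = \<kappa> * sin t"
    and momentum_b: "\<And>t. t \<in> {0<..<pi} \<Longrightarrow>
      (cos t * u t - sin t * w t) * b' t + b t * u t / sin t
        - \<alpha> * (sin t * u t + cos t * w t) * b t = 0"
    and momentum_w: "\<And>t. t \<in> {0<..<pi} \<Longrightarrow>
      (cos t * u t - sin t * w t) * w' t - \<alpha> * (sin t * u t + cos t * w t) * w t = \<kappa> * cos t"
    and incompressible: "\<And>t. t \<in> {0<..<pi} \<Longrightarrow>
      cos t * u' t - sin t * w' t + u t / sin t - \<alpha> * (sin t * u t + cos t * w t) = 0"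
begin

section \<open>Spherical components and the algebraic relation they satisfy\<close>

definition a where "a t = cos t * u t - sin t * w t"
definition f where "f t = sin t * u t + cos t * w t"

lemma sin_pos: "t \<in> {0<..<pi} \<Longrightarrow> sin t > 0"
  by (simp add: sin_gt_zero)

lemma u_eq: "u t = sin t * f t + cos t * a t"
proof -
  have "sin t * f t + cos t * a t = ((sin t)\<^sup>2 + (cos t)\<^sup>2) * u t"
    unfolding a_def f_def by algebra
  then show ?thesis by simp
qed

lemma w_eq: "w t = cos t * f t - sin t * a t"
proof -
  have "cos t * f t - sin t * a t = ((sin t)\<^sup>2 + (cos t)\<^sup>2) * w t"
    unfolding a_def f_def by algebra
  then show ?thesis by simp
qed

text \<open>The divergence equation contains \<open>u'\<close> and \<open>w'\<close> only in the
  combination that occurs in the derivative of \<open>a\<close>, so this derivative is an algebraic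
  expression in the components.\<close>

lemma da:
  assumes t: "t \<in> {0<..<pi}"
  shows "(a has_real_derivative (\<alpha> - 1) * f t - u t / sin t) (at t)"
proof -
  have "((\<lambda>t. cos t * u t - sin t * w t) has_real_derivative
      cos t * u' t - sin t * u t - (sin t * w' t + cos t * w t)) (at t)"
    by (rule derivative_eq_intros du[OF t] dw[OF t] refl | simp)+
  moreover have "cos t * u' t - sin t * u t - (sin t * w' t + cos t * w t)
      = (\<alpha> - 1) * f t - u t / sin t"
    using incompressible[OF t] by (simp add: f_def algebra_simps)
  ultimately show ?thesis unfolding a_def[abs_def] by simp
qed

text \<open>In \<open>cos t\<close> times \<open>momentum_u\<close> minus \<open>sin t\<close> times
  \<open>momentum_w\<close> the pressure cancels. Derivatives remain only in the combination
  \<open>cos t * u' t - sin t * w' t\<close>, which incompressibility makes algebraic; then the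
  \<alpha> terms cancel as well.\<close>

lemma a_u:
  assumes t: "t \<in> {0<..<pi}"
  shows "a t * u t = - (b t)\<^sup>2 * cos t"
proof -
  have s: "sin t > 0" using sin_pos[OF t] .
  have "a t * (cos t * u' t - sin t * w' t) - (b t)\<^sup>2 * cos t / sin t - \<alpha> * f t * a t = 0"
    using arg_cong[OF momentum_u[OF t], of "\<lambda>x. cos t * x"]
      arg_cong[OF momentum_w[OF t], of "\<lambda>x. sin t * x"]
    unfolding a_def[symmetric] f_def[symmetric]
    by (simp add: a_def algebra_simps)
  moreover have "cos t * u' t - sin t * w' t = \<alpha> * f t - u t / sin t"
    using incompressible[OF t] by (simp add: f_def)
  ultimately have "a t * (\<alpha> * f t - u t / sin t) - (b t)\<^sup>2 * cos t / sin t - \<alpha> * f t * a t = 0"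
    by simp
  then have "sin t * (a t * u t + (b t)\<^sup>2 * cos t) = 0"
    using s by (simp add: field_simps)
  with s show ?thesis by simp
qed

text \<open>Eliminate \<open>f\<close> between \<open>u_eq\<close> and \<open>w_eq\<close> and
  insert \<open>a_u\<close>. The right-hand side is negative where \<open>a\<close> is nonzero,
  which fixes the sign of \<open>N\<close> below.\<close>

lemma s_w:
  assumes t: "t \<in> {0<..<pi}"
  shows "a t * sin t * w t = - ((a t)\<^sup>2 + (b t)\<^sup>2 * (cos t)\<^sup>2)"
proof -
  have "a t * sin t * w t = a t * u t * cos t - (a t)\<^sup>2 * ((sin t)\<^sup>2 + (cos t)\<^sup>2)"
    unfolding u_eq[of t] w_eq[of t] power2_eq_square by (simp only: algebra_simps)
  then have "a t * sin t * w t = a t * u t * cos t - (a t)\<^sup>2" by simp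
  then show ?thesis by (simp add: a_u[OF t] power2_eq_square)
qed

text \<open>The derivative of the relation \<open>a_u\<close>, multiplied by \<open>a\<close>,
  contains derivatives only as \<open>a * u'\<close> and \<open>a * b'\<close>, and the momentum
  equations replace both. All that survives is \<open>a * \<kappa> * sin\<close>.\<close>

lemma pressure_zero:
  assumes t: "t \<in> {0<..<pi}" and at: "a t \<noteq> 0"
  shows "\<kappa> = 0"
proof -
  have s: "sin t > 0" using sin_pos[OF t] .
  have d0: "((\<lambda>t. a t * u t + (b t)\<^sup>2 * cos t) has_real_derivative
      ((\<alpha> - 1) * f t - u t / sin t) * u t + a t * u' t + 2 * b t * b' t * cos t - (b t)\<^sup>2 * sin t) (at t)"
    by (rule derivative_eq_intros da[OF t] du[OF t] db[OF t] refl | simp)+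
  \<comment> \<open>By \<open>a_u\<close> the function differentiated above vanishes on the whole
    open interval.\<close>
  have "((\<lambda>t. 0) has_real_derivative
      ((\<alpha> - 1) * f t - u t / sin t) * u t + a t * u' t + 2 * b t * b' t * cos t - (b t)\<^sup>2 * sin t) (at t)"
    by (rule has_field_derivative_transform_within_open[OF d0, of "{0<..<pi}"])
      (use t a_u in auto)
  then have e: "((\<alpha> - 1) * f t - u t / sin t) * u t + a t * u' t + 2 * b t * b' t * cos t
      - (b t)\<^sup>2 * sin t = 0"
    by (metis DERIV_const DERIV_unique)
  have m1: "a t * u' t = (b t)\<^sup>2 / sin t + \<alpha> * f t * u t + \<kappa> * sin t"
    using momentum_u[OF t] by (simp add: a_def f_def)
  have m2: "a t * b' t = \<alpha> * f t * b t - b t * u t / sin t"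
    using momentum_b[OF t] by (simp add: a_def f_def)
  have B: "(b t)\<^sup>2 * cos t = - (a t * u t)" using a_u[OF t] by simp
  have c: "(cos t)\<^sup>2 = 1 - (sin t)\<^sup>2" by (rule cos_squared_eq)
  have "0 = a t * (((\<alpha> - 1) * f t - u t / sin t) * u t + a t * u' t + 2 * b t * b' t * cos t
      - (b t)\<^sup>2 * sin t)" using e by simp
  also have "\<dots> = a t * ((\<alpha> - 1) * f t - u t / sin t) * u t + a t * (a t * u' t)
      + 2 * b t * cos t * (a t * b' t) - a t * (b t)\<^sup>2 * sin t"
    by (simp add: algebra_simps)
  also have "\<dots> = a t * ((\<alpha> - 1) * f t - u t / sin t) * u t
      + a t * ((b t)\<^sup>2 / sin t + \<alpha> * f t * u t + \<kappa> * sin t)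
      + 2 * ((b t)\<^sup>2 * cos t) * (\<alpha> * f t - u t / sin t) - a t * (b t)\<^sup>2 * sin t"
    unfolding m1 m2 by (simp add: power2_eq_square algebra_simps)
  also have "\<dots> = a t * (u t * u t - u t * f t * sin t + (b t)\<^sup>2 * (1 - (sin t)\<^sup>2) + \<kappa> * (sin t)\<^sup>2) / sin t"
    unfolding B using s by (simp add: field_simps power2_eq_square)
  also have "\<dots> = a t * (u t * u t - u t * f t * sin t + ((b t)\<^sup>2 * cos t) * cos t + \<kappa> * (sin t)\<^sup>2) / sin t"
    unfolding c[symmetric] by (simp add: power2_eq_square algebra_simps)
  \<comment> \<open>The factor multiplying \<open>u t\<close> is zero by \<open>u_eq\<close>, so
    only the pressure term is left.\<close>
  also have "\<dots> = a t * (u t * (u t - (sin t * f t + cos t * a t)) + \<kappa> * (sin t)\<^sup>2) / sin t"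
    unfolding B by (simp add: algebra_simps)
  also have "\<dots> = a t * \<kappa> * sin t"
    unfolding u_eq[symmetric] using s by (simp add: power2_eq_square)
  finally show ?thesis using at s by simp
qed

text \<open>Multiplying by \<open>sin t\<close> turns \<open>u t / sin t\<close> into
  \<open>u t\<close>, whose \<open>a\<close> part cancels against the product rule. If \<alpha>
  \<noteq> 2, then \<open>a * sin\<close> is a constant multiple of the angular part of the stream
  function.\<close>

lemma ds:
  assumes t: "t \<in> {0<..<pi}"
  shows "((\<lambda>t. a t * sin t) has_real_derivative (\<alpha> - 2) * f t * sin t) (at t)"
proof -
  have "((\<lambda>t. a t * sin t) has_real_derivative
      ((\<alpha> - 1) * f t - u t / sin t) * sin t + a t * cos t) (at t)"
    by (rule derivative_eq_intros da[OF t] refl | simp)+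
  moreover have "((\<alpha> - 1) * f t - u t / sin t) * sin t + a t * cos t = (\<alpha> - 2) * f t * sin t"
    using sin_pos[OF t] u_eq[of t] by (simp add: field_simps)
  ultimately show ?thesis by simp
qed

text \<open>An equation \<open>a g' = m f g\<close> says that \<open>g\<close> times the power -m of
  the radius is constant along the flow. The quotient of \<open>a * sin\<close> by \<open>w\<close>
  has m = -2 whatever \<alpha> is, so it serves as the reference solution. The sign makes it
  positive. It is considered only where \<open>a\<close>, and hence \<open>w\<close>, is
  nonzero.\<close>

definition N where "N t = - (a t * sin t) / w t"

lemma N_pos:
  assumes t: "t \<in> {0<..<pi}" and at: "a t \<noteq> 0"
  shows "w t \<noteq> 0" "N t > 0"
proof -
  have "(a t)\<^sup>2 + (b t)\<^sup>2 * (cos t)\<^sup>2 > 0"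
    using at by (simp add: add_pos_nonneg)
  then have sw: "a t * sin t * w t < 0" using s_w[OF t] by simp
  then show w: "w t \<noteq> 0" by auto
  have "N t = - (a t * sin t * w t) / (w t)\<^sup>2"
    using w by (simp add: N_def power2_eq_square)
  then show "N t > 0" using sw w by (simp add: divide_neg_pos)
qed

text \<open>The quotient rule with \<open>ds\<close> and the axial momentum equation; the latter is
  linear and homogeneous in \<open>w\<close> once \<kappa> = 0.\<close>

lemma dN:
  assumes t: "t \<in> {0<..<pi}" and at: "a t \<noteq> 0"
  shows "(N has_real_derivative - 2 * (f t / a t) * N t) (at t)"
proof -
  have w: "w t \<noteq> 0" using N_pos[OF t at] by simp
  have k: "\<kappa> = 0" using pressure_zero[OF t at] .
  have "((\<lambda>t. - (a t * sin t) / w t) has_real_derivative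
     (- ((\<alpha> - 2) * f t * sin t) * w t - (- (a t * sin t)) * w' t) / (w t * w t)) (at t)"
    by (intro DERIV_divide DERIV_minus ds[OF t] dw[OF t] w)
  moreover have "a t * w' t = \<alpha> * f t * w t"
    using momentum_w[OF t] k by (simp add: a_def f_def)
  then have "(- ((\<alpha> - 2) * f t * sin t) * w t - (- (a t * sin t)) * w' t)
      = 2 * f t * sin t * w t"
    by (simp add: algebra_simps)
  moreover have "2 * f t * sin t * w t / (w t * w t) = - 2 * (f t / a t) * N t"
    using w at by (simp add: N_def)
  ultimately show ?thesis unfolding N_def[abs_def] by (simp only:)
qed

text \<open>The hypothesis says that \<open>g\<close> grows at the relative rate
  \<open>2 * k * f / a\<close>, and by \<open>dN\<close> the factor \<open>N powr k\<close> grows at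
  the opposite rate. Hence \<open>g * N powr k\<close> has derivative zero and is constant on the
  connected set \<open>I\<close>.\<close>

lemma N_power_invariant:
  assumes I: "open I" "connected I" "I \<subseteq> {0<..<pi}" and a: "\<And>t. t \<in> I \<Longrightarrow> a t \<noteq> 0"
    and g: "\<And>t. t \<in> I \<Longrightarrow> (g has_real_derivative g' t) (at t)"
    and e: "\<And>t. t \<in> I \<Longrightarrow> a t * g' t = 2 * k * f t * g t"
  obtains c where "\<And>t. t \<in> I \<Longrightarrow> g t = c * N t powr (- k)"
proof -
  have "((\<lambda>t. g t * N t powr k) has_real_derivative 0) (at t)" if t: "t \<in> I" for t
  proof -
    have t': "t \<in> {0<..<pi}" and at: "a t \<noteq> 0" using I a t by auto
    have N: "N t > 0" using N_pos[OF t' at] by simp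
    have "((\<lambda>t. g t * N t powr k) has_real_derivative
      g' t * N t powr k + (N t powr k * (0 * ln (N t) + (- 2 * (f t / a t) * N t) * k / N t)) * g t) (at t)"
      by (intro DERIV_mult g[OF t] DERIV_powr dN[OF t' at] N DERIV_const)
    moreover have "g' t * N t powr k
        + (N t powr k * (0 * ln (N t) + (- 2 * (f t / a t) * N t) * k / N t)) * g t
       = N t powr k * (a t * g' t - 2 * k * f t * g t) / a t"
      using N at by (simp add: field_simps)
    ultimately show ?thesis by (simp only: e[OF t]) simp
  qed
  note d0 = this
  have "continuous_on I (\<lambda>t. g t * N t powr k)"
    using d0 DERIV_isCont continuous_at_imp_continuous_on by blast
  then obtain c where c: "\<And>t. t \<in> I \<Longrightarrow> g t * N t powr k = c"
    using DERIV_zero_connected_constant[OF I(2,1) finite.emptyI, of "\<lambda>t. g t * N t powr k"] d0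
    by auto
  have "g t = c * N t powr (- k)" if t: "t \<in> I" for t
  proof -
    have "N t > 0" using N_pos(2)[of t] I a t by blast
    then show ?thesis using c[OF t] by (auto simp: powr_minus field_simps)
  qed
  then show ?thesis using that by blast
qed

text \<open>Both \<open>w\<close> and \<open>b * sin\<close> are constants times powers of
  \<open>N\<close>. Inserted into \<open>s_w\<close>, multiplied by the square of the sine, they
  give every term the factor \<open>N powr (1 - \<alpha>)\<close>; cancelling it leaves an equation
  linear in \<open>N\<close>.\<close>

lemma profile_on_interval:
  assumes I: "open I" "connected I" "I \<subseteq> {0<..<pi}" "I \<noteq> {}" and a: "\<And>t. t \<in> I \<Longrightarrow> a t \<noteq> 0"
  obtains w\<^sub>1 l\<^sub>1 where "w\<^sub>1 \<noteq> 0"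
    "\<And>t. t \<in> I \<Longrightarrow> N t = (sin t)\<^sup>2 - (l\<^sub>1 / w\<^sub>1)\<^sup>2 * (cos t)\<^sup>2"
    "\<And>t. t \<in> I \<Longrightarrow> w t = w\<^sub>1 * N t powr (- \<alpha> / 2)"
    "\<And>t. t \<in> I \<Longrightarrow> b t * sin t = l\<^sub>1 * N t powr ((1 - \<alpha>) / 2)"
proof -
  have k: "\<kappa> = 0" using I a pressure_zero by blast
  have "a t * w' t = 2 * (\<alpha> / 2) * f t * w t" if t: "t \<in> I" for t
    using momentum_w[of t] I(3) t k by (auto simp: a_def f_def)
  then obtain w\<^sub>1 where w1: "\<And>t. t \<in> I \<Longrightarrow> w t = w\<^sub>1 * N t powr (- (\<alpha> / 2))"
    using N_power_invariant[OF I(1-3) a, of w w' "\<alpha> / 2"] dw I(3) by blast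
  have dl: "((\<lambda>t. b t * sin t) has_real_derivative b' t * sin t + b t * cos t) (at t)"
    if t: "t \<in> I" for t
    using I(3) t by (auto intro!: derivative_eq_intros db)
  \<comment> \<open>Conservation of angular momentum: the term \<open>b * u / sin\<close> of the
    azimuthal equation and the product rule for \<open>b * sin\<close> together lower the
    coefficient from \<alpha> to \<alpha> - 1.\<close>
  have el: "a t * (b' t * sin t + b t * cos t) = 2 * ((\<alpha> - 1) / 2) * f t * (b t * sin t)"
    if t: "t \<in> I" for t
  proof -
    have t': "t \<in> {0<..<pi}" using I(3) t by auto
    have "a t * b' t = \<alpha> * f t * b t - b t * u t / sin t"
      using momentum_b[OF t'] by (simp add: a_def f_def)
    then have "a t * (b' t * sin t + b t * cos t)
      = (\<alpha> * f t * b t - b t * u t / sin t) * sin t + a t * b t * cos t"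
      by algebra
    also have "\<dots> = \<alpha> * f t * b t * sin t - b t * u t + a t * b t * cos t"
      using sin_pos[OF t'] by (simp add: field_simps)
    also have "\<dots> = 2 * ((\<alpha> - 1) / 2) * f t * (b t * sin t)"
      unfolding u_eq[of t] by (simp add: algebra_simps)
    finally show ?thesis .
  qed
  obtain l\<^sub>1 where l1: "\<And>t. t \<in> I \<Longrightarrow> b t * sin t = l\<^sub>1 * N t powr (- ((\<alpha> - 1) / 2))"
    using N_power_invariant[OF I(1-3) a dl el] by blast
  obtain t\<^sub>0 where t0: "t\<^sub>0 \<in> I" using I(4) by blast
  then have "w t\<^sub>0 \<noteq> 0" using I(3) a[OF t0] N_pos(1)[of t\<^sub>0] by blast
  then have w10: "w\<^sub>1 \<noteq> 0" using w1[OF t0] by auto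
  have "N t = (sin t)\<^sup>2 - (l\<^sub>1 / w\<^sub>1)\<^sup>2 * (cos t)\<^sup>2" if t: "t \<in> I" for t
  proof -
    have t': "t \<in> {0<..<pi}" and at: "a t \<noteq> 0" using I(3) t a by auto
    have s: "sin t > 0" using sin_pos[OF t'] .
    have N: "w t \<noteq> 0" "N t > 0" using N_pos[OF t' at] .
    have as: "a t * sin t = - (N t * w t)" using N by (simp add: N_def)
    have "N t * (w t)\<^sup>2 * (sin t)\<^sup>2 = - (a t * sin t * w t) * (sin t)\<^sup>2"
      unfolding as by (simp add: power2_eq_square)
    also have "\<dots> = (a t * sin t)\<^sup>2 + (b t * sin t)\<^sup>2 * (cos t)\<^sup>2"
      unfolding s_w[OF t'] by (simp add: power2_eq_square algebra_simps)
    finally have A: "N t * (w t)\<^sup>2 * (sin t)\<^sup>2 = (N t * w t)\<^sup>2 + (b t * sin t)\<^sup>2 * (cos t)\<^sup>2"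
      unfolding as by simp
    have W: "(w t)\<^sup>2 = w\<^sub>1\<^sup>2 * N t powr (- \<alpha>)"
      unfolding w1[OF t] by (simp add: power_mult_distrib power2_eq_square flip: powr_add)
    have L: "(b t * sin t)\<^sup>2 = l\<^sub>1\<^sup>2 * (N t * N t powr (- \<alpha>))"
    proof -
      have "(N t powr (- ((\<alpha> - 1) / 2)))\<^sup>2 = N t powr (1 + (- \<alpha>))"
        by (simp add: power2_eq_square flip: powr_add)
      also have "\<dots> = N t * N t powr (- \<alpha>)" using N(2) by (simp add: powr_mult_base)
      finally show ?thesis unfolding l1[OF t] by (simp add: power_mult_distrib)
    qed
    \<comment> \<open>The common factor \<open>N powr (1 - \<alpha>)\<close> of all terms of
      \<open>A\<close> after \<open>W\<close> and \<open>L\<close> are inserted.\<close>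
    define q where "q = N t * N t powr (- \<alpha>)"
    have q: "q > 0" using N(2) by (simp add: q_def)
    have "q * (w\<^sub>1\<^sup>2 * (sin t)\<^sup>2) = q * (w\<^sub>1\<^sup>2 * N t + l\<^sub>1\<^sup>2 * (cos t)\<^sup>2)"
      using A unfolding power_mult_distrib[of "N t" "w t"] W L q_def
      by (simp add: power2_eq_square algebra_simps)
    then have "w\<^sub>1\<^sup>2 * (sin t)\<^sup>2 = w\<^sub>1\<^sup>2 * N t + l\<^sub>1\<^sup>2 * (cos t)\<^sup>2"
      using q by simp
    then have "N t = (w\<^sub>1\<^sup>2 * (sin t)\<^sup>2 - l\<^sub>1\<^sup>2 * (cos t)\<^sup>2) / w\<^sub>1\<^sup>2"
      using w10 by simp
    then show ?thesis using w10 by (simp add: diff_divide_distrib power_divide)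
  qed
  note N_eq = this
  have e: "- (\<alpha> / 2) = - \<alpha> / 2" "- ((\<alpha> - 1) / 2) = (1 - \<alpha>) / 2"
    by (simp_all only: minus_divide_left minus_diff_eq)
  show ?thesis using that[OF w10 N_eq w1[unfolded e] l1[unfolded e]] .
qed

end

section \<open>The support of the solution\<close>

text \<open>On the interval the first factor is positive exactly beyond \<beta> and the second
  exactly before \<open>pi - \<beta>\<close>. Since \<beta> is below \<open>pi / 2\<close>, they are
  never negative together.\<close>

lemma sin_mult_sin_pos_iff:
  fixes \<beta> t :: real
  assumes \<beta>: "0 \<le> \<beta>" "\<beta> < pi / 2" and t: "0 < t" "t < pi"
  shows "0 < sin (t - \<beta>) * sin (t + \<beta>) \<longleftrightarrow> \<beta> < t \<and> t < pi - \<beta>"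
proof -
  consider "t \<le> \<beta>" | "\<beta> < t" "t < pi - \<beta>" | "pi - \<beta> \<le> t" by linarith
  then show ?thesis
  proof cases
    case 1
    then have "sin (\<beta> - t) \<ge> 0" "sin (t + \<beta>) > 0"
      using \<beta> t by (auto intro!: sin_ge_zero sin_gt_zero)
    then have "sin (\<beta> - t) * sin (t + \<beta>) \<ge> 0" by simp
    moreover have "sin (t - \<beta>) = - sin (\<beta> - t)" using sin_minus[of "\<beta> - t"] by simp
    ultimately show ?thesis using 1 by simp
  next
    case 2
    then have "sin (t - \<beta>) > 0" "sin (t + \<beta>) > 0"
      using \<beta> t by (auto intro!: sin_gt_zero)
    then show ?thesis using 2 by simp
  next
    case 3
    have "sin (t - \<beta>) > 0" by (rule sin_gt_zero) (use 3 \<beta> t in linarith)+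
    moreover have "sin (t + \<beta> - pi) \<ge> 0" by (rule sin_ge_zero) (use 3 \<beta> t in linarith)+
    ultimately have "sin (t - \<beta>) * sin (t + \<beta> - pi) \<ge> 0"
      by (intro mult_nonneg_nonneg) simp_all
    moreover have "sin (t + \<beta>) = - sin (t + \<beta> - pi)"
      using sin_periodic_pi[of "t + \<beta> - pi"] by (simp only: diff_add_cancel)
    ultimately show ?thesis using 3 by (simp only: mult_minus_right) linarith
  qed
qed

lemma sin_diff_mult_sin_add:
  fixes \<beta> t :: real
  shows "sin (t - \<beta>) * sin (t + \<beta>) = (cos \<beta>)\<^sup>2 * (sin t)\<^sup>2 - (sin \<beta>)\<^sup>2 * (cos t)\<^sup>2"
  unfolding sin_diff sin_add power2_eq_square by (simp only: algebra_simps)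

text \<open>The band function becomes a product with explicit zeros. This yields its sign in
  \<open>band_iff\<close> and, for positive \<beta>, the simplicity of its zero at \<beta>, on which
  the condition at the edge depends.\<close>

lemma sin_diff_mult_sin_add_tan:
  fixes \<beta> r t :: real
  assumes "0 \<le> \<beta>" "\<beta> < pi / 2" "tan \<beta> = \<bar>r\<bar>"
  shows "sin (t - \<beta>) * sin (t + \<beta>) = (cos \<beta>)\<^sup>2 * ((sin t)\<^sup>2 - r\<^sup>2 * (cos t)\<^sup>2)"
proof -
  have "cos \<beta> > 0" using assms by (intro cos_gt_zero_pi) auto
  moreover have "r\<^sup>2 = (sin \<beta>)\<^sup>2 / (cos \<beta>)\<^sup>2"
    using assms(3) by (metis power2_abs power_divide tan_def)
  ultimately have "(sin \<beta>)\<^sup>2 = (cos \<beta>)\<^sup>2 * r\<^sup>2" by simp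
  then show ?thesis unfolding sin_diff_mult_sin_add by (simp add: right_diff_distrib)
qed

lemma band_iff:
  fixes \<beta> r t :: real
  assumes \<beta>: "0 \<le> \<beta>" "\<beta> < pi / 2" "tan \<beta> = \<bar>r\<bar>" and t: "t \<in> {0<..<pi}"
  shows "(sin t)\<^sup>2 - r\<^sup>2 * (cos t)\<^sup>2 > 0 \<longleftrightarrow> t \<in> {\<beta><..<pi - \<beta>}"
proof -
  have "cos \<beta> > 0" using \<beta> by (intro cos_gt_zero_pi) auto
  then show ?thesis
    using sin_mult_sin_pos_iff[OF \<beta>(1,2), of t] t
    by (auto simp: sin_diff_mult_sin_add_tan[OF \<beta>] zero_less_mult_iff)
qed

context axisymmetric_profile
begin

section \<open>The connected components of the support\<close>

lemma continuous_on_a: "continuous_on {0<..<pi} a"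
  using da DERIV_isCont continuous_at_imp_continuous_on by blast

definition support where "support = {t \<in> {0<..<pi}. a t \<noteq> 0}"

lemma open_support: "open support"
proof -
  have "support = {0<..<pi} \<inter> a -` (- {0})" by (auto simp: support_def)
  then show ?thesis using continuous_open_preimage[OF continuous_on_a, of "- {0}"]
    by (simp add: open_Compl)
qed

text \<open>Positivity of \<open>N\<close> puts the component inside the band. It is open, and it is
  relatively closed in the band: at a limit point inside, the formula for \<open>a * sin\<close>
  persists by continuity and is nonzero, so the point lies in the support and thus in the component.
  A nonempty clopen subset of the connected band is the whole band.\<close>

lemma component_is_band:
  assumes t0: "t\<^sub>0 \<in> support"
  obtains w\<^sub>1 l\<^sub>1 \<beta> where "w\<^sub>1 \<noteq> 0" "0 \<le> \<beta>" "\<beta> < pi / 2" "tan \<beta> = \<bar>l\<^sub>1 / w\<^sub>1\<bar>"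
    "connected_component_set support t\<^sub>0 = {\<beta><..<pi - \<beta>}"
    "\<And>t. t \<in> {\<beta><..<pi - \<beta>} \<Longrightarrow> N t = (sin t)\<^sup>2 - (l\<^sub>1 / w\<^sub>1)\<^sup>2 * (cos t)\<^sup>2"
    "\<And>t. t \<in> {\<beta><..<pi - \<beta>} \<Longrightarrow> w t = w\<^sub>1 * N t powr (- \<alpha> / 2)"
    "\<And>t. t \<in> {\<beta><..<pi - \<beta>} \<Longrightarrow> b t * sin t = l\<^sub>1 * N t powr ((1 - \<alpha>) / 2)"
proof -
  define I where "I = connected_component_set support t\<^sub>0"
  have I: "open I" "connected I" "I \<noteq> {}" "I \<subseteq> support"
    using t0 open_support unfolding I_def
    by (auto simp: open_connected_component connected_component_subset intro!: exI[of _ t\<^sub>0])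
  have I': "I \<subseteq> {0<..<pi}" "\<And>t. t \<in> I \<Longrightarrow> a t \<noteq> 0"
    using I(4) by (auto simp: support_def)
  obtain w\<^sub>1 l\<^sub>1 where w1: "w\<^sub>1 \<noteq> 0"
    and N: "\<And>t. t \<in> I \<Longrightarrow> N t = (sin t)\<^sup>2 - (l\<^sub>1 / w\<^sub>1)\<^sup>2 * (cos t)\<^sup>2"
    and w: "\<And>t. t \<in> I \<Longrightarrow> w t = w\<^sub>1 * N t powr (- \<alpha> / 2)"
    and b: "\<And>t. t \<in> I \<Longrightarrow> b t * sin t = l\<^sub>1 * N t powr ((1 - \<alpha>) / 2)"
    using profile_on_interval[OF I(1,2) I'(1) I(3) I'(2)] by blast
  define \<beta> where "\<beta> = arctan \<bar>l\<^sub>1 / w\<^sub>1\<bar>"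
  have \<beta>: "0 \<le> \<beta>" "\<beta> < pi / 2" "tan \<beta> = \<bar>l\<^sub>1 / w\<^sub>1\<bar>"
    unfolding \<beta>_def by (simp, rule arctan_ubound, rule tan_arctan)
  \<comment> \<open>The formula for \<open>N\<close>, now meaningful at every angle; agreement with
    \<open>N\<close> is known only on \<open>I\<close>.\<close>
  define M where "M t = (sin t)\<^sup>2 - (l\<^sub>1 / w\<^sub>1)\<^sup>2 * (cos t)\<^sup>2" for t
  have M_pos: "M t > 0 \<longleftrightarrow> t \<in> {\<beta><..<pi - \<beta>}" if "t \<in> {0<..<pi}" for t
    unfolding M_def using band_iff[OF \<beta> that] .
  define J where "J = {\<beta><..<pi - \<beta>}"
  have J: "J \<subseteq> {0<..<pi}" using \<beta> by (auto simp: J_def)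
  have IJ: "I \<subseteq> J"
  proof
    fix t assume t: "t \<in> I"
    then have "N t > 0" using N_pos(2)[of t] I' by blast
    then show "t \<in> J" using N[OF t] M_pos[of t] I'(1) t by (auto simp: J_def M_def)
  qed
  have "x \<in> I" if x: "x islimpt I" "x \<in> J" for x
  proof -
    have x': "x \<in> {0<..<pi}" "M x > 0" using J x(2) M_pos by (auto simp: J_def)
    have nt: "at x within I \<noteq> bot" using x(1) by (simp add: trivial_limit_within)
    have lim: "((\<lambda>t. a t * sin t) \<longlongrightarrow> a x * sin x) (at x within I)"
      using DERIV_isCont[OF ds[OF x'(1)]] unfolding isCont_def by (rule tendsto_within_subset) simp
    have lim': "((\<lambda>t. - M t * (w\<^sub>1 * M t powr (- \<alpha> / 2))) \<longlongrightarrow> - M x * (w\<^sub>1 * M x powr (- \<alpha> / 2)))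
        (at x within I)"
      using x'(2) unfolding M_def by (intro tendsto_intros) auto
    have "eventually (\<lambda>t. - M t * (w\<^sub>1 * M t powr (- \<alpha> / 2)) = a t * sin t) (at x within I)"
    proof -
      have "- M t * (w\<^sub>1 * M t powr (- \<alpha> / 2)) = a t * sin t" if t: "t \<in> I" for t
      proof -
        have "w t \<noteq> 0" using N_pos(1)[of t] I' t by blast
        then have "a t * sin t = - N t * w t" by (simp add: N_def)
        then show ?thesis using w[OF t] N[OF t] by (simp add: M_def)
      qed
      then show ?thesis by (auto simp: eventually_at_filter)
    qed
    \<comment> \<open>Both sides are the limit of \<open>a * sin\<close> along \<open>I\<close>. As
      \<open>M x\<close> is positive, the right-hand side is nonzero.\<close>
    then have "a x * sin x = - M x * (w\<^sub>1 * M x powr (- \<alpha> / 2))"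
      by (rule tendsto_unique[OF nt lim Lim_transform_eventually[OF lim']])
    then have "a x \<noteq> 0" using x'(2) w1 by auto
    then have "x \<in> support" using x' by (simp add: support_def)
    then show ?thesis
      using closedin_connected_component[of support t\<^sub>0] x(1)
      unfolding closedin_limpt I_def by blast
  qed
  then have "closedin (top_of_set J) I" using IJ by (auto simp: closedin_limpt)
  moreover have "openin (top_of_set J) I" using IJ I(1) by (simp add: open_subset)
  moreover have "connected J" by (simp add: J_def)
  ultimately have "I = J" using I(3) unfolding connected_clopen by blast
  then show ?thesis using that[of w\<^sub>1 \<beta> l\<^sub>1] w1 \<beta> N w b by (simp add: I_def J_def)
qed

text \<open>Every component is a band symmetric about the equator, so it contains
  \<open>pi / 2\<close>, and all components coincide.\<close>

lemma support_component:
  assumes "t\<^sub>0 \<in> support"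
  shows "connected_component_set support t\<^sub>0 = support"
proof -
  have "pi / 2 \<in> connected_component_set support t" if t: "t \<in> support" for t
  proof -
    obtain \<beta> where "\<beta> < pi / 2" "connected_component_set support t = {\<beta><..<pi - \<beta>}"
      by (rule component_is_band[OF t]) (rule that)
    then show ?thesis by simp
  qed
  then have "connected_component support t\<^sub>0 t" if "t \<in> support" for t
    using assms that connected_component_sym connected_component_trans by blast
  then show ?thesis using connected_component_subset[of support t\<^sub>0] by blast
qed

text \<open>If \<open>a\<close> vanishes on one side of \<open>t\<close>, then its derivative at
  \<open>t\<close> is zero too, even at an edge of the support. By \<open>da\<close> this means
  \<open>(\<alpha> - 2) * f t = 0\<close>, while the momentum equations give
  \<open>\<alpha> * f t * u t = 0\<close> and \<open>\<alpha> * f t * w t = 0\<close>; together they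
  force \<open>f t = 0\<close>. The equator is excluded because \<open>a_u\<close> does not control
  \<open>b\<close> there.\<close>

lemma zero_off_support:
  assumes k: "\<kappa> = 0" and t: "t \<in> {0<..<pi}" "t \<noteq> pi / 2"
    and side: "(\<forall>s\<in>{0<..t}. a s = 0) \<or> (\<forall>s\<in>{t..<pi}. a s = 0)"
  shows "u t = 0" "b t = 0" "w t = 0"
proof -
  have a: "a t = 0" using side t by auto
  define D where "D = (\<alpha> - 1) * f t - u t / sin t"
  have lim: "((\<lambda>s. (a s - a t) / (s - t)) \<longlongrightarrow> D) (at t)"
    using da[OF t(1)] by (simp add: has_field_derivative_iff D_def)
  have "D = 0"
    using side
  proof
    assume z: "\<forall>s\<in>{0<..t}. a s = 0"
    have "eventually (\<lambda>s. s \<in> {0<..<t}) (at_left t)"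
      using t by (intro eventually_at_left_real) auto
    then have "eventually (\<lambda>s. (a s - a t) / (s - t) = 0) (at_left t)"
      by eventually_elim (use z a in auto)
    then have "((\<lambda>s. (a s - a t) / (s - t)) \<longlongrightarrow> 0) (at_left t)" by (rule tendsto_eventually)
    moreover have "((\<lambda>s. (a s - a t) / (s - t)) \<longlongrightarrow> D) (at_left t)"
      using lim by (rule tendsto_within_subset) simp
    ultimately show ?thesis by (intro tendsto_unique[OF trivial_limit_at_left_real])
  next
    assume z: "\<forall>s\<in>{t..<pi}. a s = 0"
    have "eventually (\<lambda>s. s \<in> {t<..<pi}) (at_right t)"
      using t by (intro eventually_at_right_real) auto
    then have "eventually (\<lambda>s. (a s - a t) / (s - t) = 0) (at_right t)"
      by eventually_elim (use z a in auto)
    then have "((\<lambda>s. (a s - a t) / (s - t)) \<longlongrightarrow> 0) (at_right t)" by (rule tendsto_eventually)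
    moreover have "((\<lambda>s. (a s - a t) / (s - t)) \<longlongrightarrow> D) (at_right t)"
      using lim by (rule tendsto_within_subset) simp
    ultimately show ?thesis by (intro tendsto_unique[OF trivial_limit_at_right_real])
  qed
  have s: "sin t > 0" using sin_pos[OF t(1)] .
  have uf: "u t = sin t * f t" and wf: "w t = cos t * f t" using u_eq[of t] w_eq[of t] a by auto
  have "D = (\<alpha> - 2) * f t" using s by (simp add: D_def uf algebra_simps)
  then have f2: "(\<alpha> - 2) * f t = 0" using \<open>D = 0\<close> by simp
  have "cos t \<noteq> 0"
    using t cos_inj_pi[of t "pi / 2"] by auto
  then show b: "b t = 0" using a_u[OF t(1)] a by simp
  have "\<alpha> * f t * u t = 0" "\<alpha> * f t * w t = 0"
    using momentum_u[OF t(1)] momentum_w[OF t(1)] a b k by (simp_all add: a_def f_def)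
  then have "f t = 0" using f2 f_def[of t] by auto
  then show "u t = 0" "w t = 0" using uf wf by auto
qed

end

section \<open>Classification of the profiles\<close>

text \<open>At a simple zero of \<open>m\<close> the function \<open>g\<close> behaves like the
  power \<open>e\<close> of the distance to \<open>x\<close>. A negative exponent would make it
  unbounded, and one strictly between 0 and 1 would give it infinite slope.\<close>

lemma differentiable_power_exponent:
  fixes g m :: "real \<Rightarrow> real"
  assumes g: "(g has_real_derivative g') (at x)" and m: "(m has_real_derivative D) (at x)"
    and D: "D \<noteq> 0" "m x = 0" and c: "c \<noteq> 0" and "x < y"
    and gm: "\<And>t. t \<in> {x<..<y} \<Longrightarrow> m t > 0 \<and> g t = c * m t powr e"
  shows "e = 0 \<and> g x = c \<or> 1 \<le> e"
proof -
  have right: "eventually (\<lambda>t. t \<in> {x<..<y}) (at_right x)"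
    using \<open>x < y\<close> by (intro eventually_at_right_real) auto
  have unique: "P = c" if "eventually (\<lambda>t. h t = c) (at_right x)" "(h \<longlongrightarrow> P) (at_right x)" for h P
    using tendsto_unique[OF trivial_limit_at_right_real that(2) tendsto_eventually[OF that(1)]] .
  have glim: "(g \<longlongrightarrow> g x) (at_right x)" and mlim: "(m \<longlongrightarrow> 0) (at_right x)"
    using DERIV_isCont[OF g] DERIV_isCont[OF m] D(2)
    by (auto simp: isCont_def intro: tendsto_within_subset)
  have mpow: "((\<lambda>t. m t powr k) \<longlongrightarrow> 0) (at_right x)" if "k > 0" for k
  proof (rule tendsto_zero_powrI[OF mlim tendsto_const _ that])
    show "eventually (\<lambda>t. 0 \<le> m t) (at_right x)"
      using right by eventually_elim (use gm in \<open>auto intro: less_imp_le\<close>)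
  qed
  consider "e < 0" | "e = 0" | "0 < e" "e < 1" | "1 \<le> e" by linarith
  then show ?thesis
  proof cases
    case 1
    \<comment> \<open>The product is the constant \<open>c\<close> to the right of \<open>x\<close>,
      yet it tends to 0 because \<open>g\<close> stays bounded.\<close>
    have "eventually (\<lambda>t. g t * m t powr (- e) = c) (at_right x)"
      using right
    proof eventually_elim
      case (elim t)
      then show ?case using gm[OF elim] by (auto simp: powr_minus)
    qed
    moreover have "((\<lambda>t. g t * m t powr (- e)) \<longlongrightarrow> g x * 0) (at_right x)"
      using 1 by (intro tendsto_mult glim mpow) simp
    ultimately show ?thesis using unique c by fastforce
  next
    case 2
    have "eventually (\<lambda>t. g t = c) (at_right x)"
      using right by eventually_elim (use gm 2 in force)
    then show ?thesis using unique glim 2 by blast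
  next
    case 3
    have "((\<lambda>t. c * m t powr e) \<longlongrightarrow> c * 0) (at_right x)"
      using 3 by (intro tendsto_mult tendsto_const mpow)
    moreover have "eventually (\<lambda>t. c * m t powr e = g t) (at_right x)"
      using right by eventually_elim (use gm in simp)
    ultimately have "(g \<longlongrightarrow> c * 0) (at_right x)" by (rule Lim_transform_eventually)
    then have gx: "g x = 0" using tendsto_unique[OF trivial_limit_at_right_real glim] by simp
    have lim: "((\<lambda>t. g t / (t - x)) \<longlongrightarrow> g') (at_right x)" "((\<lambda>t. m t / (t - x)) \<longlongrightarrow> D) (at_right x)"
      using g m gx D(2) by (auto simp: has_field_derivative_iff intro: tendsto_within_subset)
    \<comment> \<open>The quotient of the two difference quotients is \<open>g t / m t\<close> and
      has a finite limit, so the product tends to 0; but it is identically \<open>c\<close>.\<close>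
    have "((\<lambda>t. m t powr (1 - e) * (g t / (t - x) / (m t / (t - x)))) \<longlongrightarrow> 0 * (g' / D)) (at_right x)"
      using 3 by (intro tendsto_mult tendsto_divide lim D mpow) simp
    moreover have "eventually (\<lambda>t. m t powr (1 - e) * (g t / (t - x) / (m t / (t - x))) = c) (at_right x)"
      using right
    proof eventually_elim
      case (elim t)
      have "m t powr (1 - e) * g t = c * (m t powr (1 - e) * m t powr e)" using gm[OF elim] by simp
      also have "m t powr (1 - e) * m t powr e = m t" using gm[OF elim] by (simp flip: powr_add)
      finally have "m t powr (1 - e) * g t / m t = c" using gm[OF elim] by (metis less_numeral_extra(3) nonzero_mult_div_cancel_right)
      then show ?case using elim by simp
    qed
    ultimately have "0 * (g' / D) = c" by (rule unique[rotated])
    then show ?thesis using c by simp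
  qed simp
qed

context axisymmetric_profile
begin

section \<open>Vanishing off the band, the exponent at its edge, and the two kinds of
  profile\<close>

lemma profile_off_band:
  assumes k: "\<kappa> = 0" and \<beta>: "0 \<le> \<beta>" "\<beta> < pi / 2" and supp: "support = {\<beta><..<pi - \<beta>}"
    and t: "t \<in> {0<..<pi}" "t \<notin> {\<beta><..<pi - \<beta>}"
  shows "u t = 0" "b t = 0" "w t = 0"
proof -
  have z: "a s = 0" if "s \<in> {0<..<pi}" "s \<notin> {\<beta><..<pi - \<beta>}" for s
    using that supp[symmetric] by (auto simp: support_def)
  have "t \<noteq> pi / 2" using t \<beta> by auto
  moreover have "(\<forall>s\<in>{0<..t}. a s = 0) \<or> (\<forall>s\<in>{t..<pi}. a s = 0)"
  proof (cases "t \<le> \<beta>")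
    case True
    then have "\<forall>s\<in>{0<..t}. a s = 0" using t(1) by (auto intro!: z)
    then show ?thesis ..
  next
    case False
    then have "\<forall>s\<in>{t..<pi}. a s = 0" using t by (auto intro!: z)
    then show ?thesis ..
  qed
  ultimately show "u t = 0" "b t = 0" "w t = 0" using zero_off_support[OF k t(1)] by auto
qed

text \<open>For positive \<beta> the edge is an interior angle, where \<open>w\<close> is
  differentiable, and the band function has a simple zero there. The value
  \<open>w \<beta> = 0\<close> excludes exponent 0, so \<open>- \<alpha> / 2\<close> is at least
  1.\<close>

lemma exponent_at_band_edge:
  assumes \<beta>: "0 < \<beta>" "\<beta> < pi / 2" "tan \<beta> = \<bar>r\<bar>" and w1: "w\<^sub>1 \<noteq> 0" and w0: "w \<beta> = 0"
    and w: "\<And>t. t \<in> {\<beta><..<pi - \<beta>} \<Longrightarrow> w t = w\<^sub>1 * ((sin t)\<^sup>2 - r\<^sup>2 * (cos t)\<^sup>2) powr (- \<alpha> / 2)"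
  shows "\<alpha> \<le> -2"
proof -
  define M where "M t = (sin t)\<^sup>2 - r\<^sup>2 * (cos t)\<^sup>2" for t
  have c: "cos \<beta> > 0" and s: "sin \<beta> > 0" using \<beta> by (auto intro!: cos_gt_zero_pi sin_gt_zero)
  have M: "M t = sin (t - \<beta>) * sin (t + \<beta>) / (cos \<beta>)\<^sup>2" for t
    using sin_diff_mult_sin_add_tan[of \<beta> r t] \<beta> c by (simp add: M_def)
  have M0: "M \<beta> = 0" by (simp add: M)
  \<comment> \<open>The slope of \<open>M\<close> at the edge, equal to
    \<open>2 * tan \<beta>\<close>.\<close>
  define D where "D = sin (2 * \<beta>) / (cos \<beta>)\<^sup>2"
  have D: "D \<noteq> 0" using s c by (simp add: D_def sin_double)
  have "((\<lambda>t. sin (t - \<beta>)) has_real_derivative cos (\<beta> - \<beta>) * (1 - 0)) (at \<beta>)"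
    "((\<lambda>t. sin (t + \<beta>)) has_real_derivative cos (\<beta> + \<beta>) * (1 + 0)) (at \<beta>)"
    by (intro DERIV_fun_sin DERIV_diff DERIV_add DERIV_ident DERIV_const)+
  from DERIV_mult[OF this]
  have "((\<lambda>t. sin (t - \<beta>) * sin (t + \<beta>)) has_real_derivative sin (2 * \<beta>)) (at \<beta>)"
    by simp
  then have dM: "((\<lambda>t. M t) has_real_derivative D) (at \<beta>)"
    unfolding M D_def by (rule DERIV_cdivide)
  have "M t > 0 \<and> w t = w\<^sub>1 * M t powr (- \<alpha> / 2)" if "t \<in> {\<beta><..<pi - \<beta>}" for t
    unfolding M_def using band_iff[of \<beta> r t] \<beta> that w[OF that] by auto
  moreover have "\<beta> \<in> {0<..<pi}" using \<beta> by auto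
  ultimately have "- \<alpha> / 2 = 0 \<and> w \<beta> = w\<^sub>1 \<or> 1 \<le> - \<alpha> / 2"
    using differentiable_power_exponent[OF dw dM D M0 w1, of "pi - \<beta>" "- \<alpha> / 2"] \<beta> by auto
  then show ?thesis using w0 w1 by auto
qed

text \<open>The support is a single band, so one pair of constants describes the whole meridian. For
  \<open>l\<^sub>1 = 0\<close> the band has no edge at an interior angle; the condition on \<alpha>
  then has to come from the poles, which the profile does not see.\<close>

lemma global_profile:
  assumes "support \<noteq> {}"
  obtains w\<^sub>1 l\<^sub>1 where "w\<^sub>1 \<noteq> 0" "\<kappa> = 0" "l\<^sub>1 \<noteq> 0 \<Longrightarrow> \<alpha> \<le> -2"
    "\<And>t. \<lbrakk>t \<in> {0<..<pi}; (sin t)\<^sup>2 - (l\<^sub>1 / w\<^sub>1)\<^sup>2 * (cos t)\<^sup>2 > 0\<rbrakk> \<Longrightarrow>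
      w t = w\<^sub>1 * ((sin t)\<^sup>2 - (l\<^sub>1 / w\<^sub>1)\<^sup>2 * (cos t)\<^sup>2) powr (- \<alpha> / 2) \<and>
      b t * sin t = l\<^sub>1 * ((sin t)\<^sup>2 - (l\<^sub>1 / w\<^sub>1)\<^sup>2 * (cos t)\<^sup>2) powr ((1 - \<alpha>) / 2) \<and>
      u t * sin t = l\<^sub>1\<^sup>2 / w\<^sub>1 * ((sin t)\<^sup>2 - (l\<^sub>1 / w\<^sub>1)\<^sup>2 * (cos t)\<^sup>2) powr (- \<alpha> / 2) * cos t"
    "\<And>t. \<lbrakk>t \<in> {0<..<pi}; (sin t)\<^sup>2 - (l\<^sub>1 / w\<^sub>1)\<^sup>2 * (cos t)\<^sup>2 \<le> 0\<rbrakk> \<Longrightarrow> u t = 0 \<and> b t = 0 \<and> w t = 0"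
proof -
  obtain t\<^sub>0 where t0: "t\<^sub>0 \<in> support" using assms by blast
  have k: "\<kappa> = 0" using t0 pressure_zero[of t\<^sub>0] by (auto simp: support_def)
  obtain w\<^sub>1 l\<^sub>1 \<beta> where w1: "w\<^sub>1 \<noteq> 0" and \<beta>: "0 \<le> \<beta>" "\<beta> < pi / 2" "tan \<beta> = \<bar>l\<^sub>1 / w\<^sub>1\<bar>"
    and comp: "connected_component_set support t\<^sub>0 = {\<beta><..<pi - \<beta>}"
    and N: "\<And>t. t \<in> {\<beta><..<pi - \<beta>} \<Longrightarrow> N t = (sin t)\<^sup>2 - (l\<^sub>1 / w\<^sub>1)\<^sup>2 * (cos t)\<^sup>2"
    and w: "\<And>t. t \<in> {\<beta><..<pi - \<beta>} \<Longrightarrow> w t = w\<^sub>1 * N t powr (- \<alpha> / 2)"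
    and b: "\<And>t. t \<in> {\<beta><..<pi - \<beta>} \<Longrightarrow> b t * sin t = l\<^sub>1 * N t powr ((1 - \<alpha>) / 2)"
    by (rule component_is_band[OF t0]) (rule that)
  have supp: "support = {\<beta><..<pi - \<beta>}" using comp support_component[OF t0] by simp
  \<comment> \<open>The remaining component follows from \<open>a_u\<close> after replacing
    \<open>a * sin\<close> by \<open>- N * w\<close>.\<close>
  have u: "u t * sin t = l\<^sub>1\<^sup>2 / w\<^sub>1 * N t powr (- \<alpha> / 2) * cos t" if t: "t \<in> {\<beta><..<pi - \<beta>}" for t
  proof -
    have t': "t \<in> {0<..<pi}" "a t \<noteq> 0" using t unfolding supp[symmetric] by (auto simp: support_def)
    have s: "sin t > 0" using sin_pos[OF t'(1)] .
    have n: "w t \<noteq> 0" "N t > 0" using N_pos[OF t'] .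
    have "N t * w t = - (a t * sin t)" using n by (simp add: N_def)
    then have "N t * w t * (u t * sin t) = - (a t * u t) * (sin t)\<^sup>2"
      by (simp add: power2_eq_square)
    also have "\<dots> = (b t * sin t)\<^sup>2 * cos t"
      unfolding a_u[OF t'(1)] by (simp add: power_mult_distrib)
    also have "\<dots> = l\<^sub>1\<^sup>2 * (N t powr ((1 - \<alpha>) / 2))\<^sup>2 * cos t"
      unfolding b[OF t] by (simp add: power_mult_distrib)
    also have "(N t powr ((1 - \<alpha>) / 2))\<^sup>2 = N t powr (1 + (- \<alpha> / 2) + (- \<alpha> / 2))"
      unfolding power2_eq_square powr_add[symmetric] by (simp add: field_simps)
    also have "\<dots> = N t * N t powr (- \<alpha> / 2) * N t powr (- \<alpha> / 2)"
      unfolding powr_add using n by simp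
    also have "l\<^sub>1\<^sup>2 * \<dots> * cos t = N t * w t * (l\<^sub>1\<^sup>2 / w\<^sub>1 * N t powr (- \<alpha> / 2) * cos t)"
      unfolding w[OF t] using w1 by simp
    finally have e: "N t * w t * (u t * sin t) = N t * w t * (l\<^sub>1\<^sup>2 / w\<^sub>1 * N t powr (- \<alpha> / 2) * cos t)" .
    have "N t * w t \<noteq> 0" using n by simp
    from mult_left_cancel[OF this] e show ?thesis by blast
  qed
  have off: "u t = 0 \<and> b t = 0 \<and> w t = 0" if "t \<in> {0<..<pi}" "t \<notin> {\<beta><..<pi - \<beta>}" for t
    using profile_off_band[OF k \<beta>(1,2) supp that] by simp
  have "\<alpha> \<le> -2" if "l\<^sub>1 \<noteq> 0"
  proof (rule exponent_at_band_edge[OF _ \<beta>(2,3) w1])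
    \<comment> \<open>A nonzero \<open>l\<^sub>1\<close> makes \<open>tan \<beta>\<close>
      nonzero.\<close>
    show "0 < \<beta>" using that w1 \<beta> by (cases "\<beta> = 0") auto
    then show "w \<beta> = 0" using off[of \<beta>] \<beta> by auto
    show "w t = w\<^sub>1 * ((sin t)\<^sup>2 - (l\<^sub>1 / w\<^sub>1)\<^sup>2 * (cos t)\<^sup>2) powr (- \<alpha> / 2)"
      if "t \<in> {\<beta><..<pi - \<beta>}" for t
      using w[OF that] N[OF that] by simp
  qed
  then show ?thesis
    using that[OF w1 k, of l\<^sub>1] w u b N off band_iff[OF \<beta>] by (auto simp: not_less[symmetric])
qed

text \<open>With \<open>a\<close> identically zero, \<open>a_u\<close> kills \<open>b\<close> off
  the equator and continuity kills it there. The derivative of \<open>a * sin\<close> and the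
  momentum equation leave only finitely many values for \<open>f\<close>, and a continuous function
  on an interval with finitely many values is constant.\<close>

lemma radial_profile:
  assumes "support = {}"
  obtains c where "(\<alpha> - 2) * c = 0" "\<alpha> * c\<^sup>2 + \<kappa> = 0"
    "\<And>t. t \<in> {0<..<pi} \<Longrightarrow> u t = c * sin t \<and> b t = 0 \<and> w t = c * cos t"
proof -
  have a: "a t = 0" if "t \<in> {0<..<pi}" for t using assms that by (auto simp: support_def)
  have uw: "u t = f t * sin t" "w t = f t * cos t" if "t \<in> {0<..<pi}" for t
    using u_eq[of t] w_eq[of t] a[OF that] by simp_all
  have b: "b t = 0" if t: "t \<in> {0<..<pi}" for t
  proof (cases "t = pi / 2")
    case False
    then have "cos t \<noteq> 0" using t cos_inj_pi[of t "pi / 2"] by auto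
    then show ?thesis using a_u[OF t] a[OF t] by simp
  next
    case True
    have "eventually (\<lambda>s. s \<in> {0<..<pi} - {t}) (at t)"
      using t by (intro eventually_at_in_open) auto
    then have "eventually (\<lambda>s. b s = 0) (at t)"
    proof eventually_elim
      case (elim s)
      then have "cos s \<noteq> 0" using True cos_inj_pi[of s "pi / 2"] by auto
      then show ?case using a_u[of s] a[of s] elim by auto
    qed
    then have "(b \<longlongrightarrow> 0) (at t)" by (rule tendsto_eventually)
    moreover have "(b \<longlongrightarrow> b t) (at t)" using DERIV_isCont[OF db[OF t]] by (simp add: isCont_def)
    ultimately show ?thesis using tendsto_unique[OF at_neq_bot] by blast
  qed
  have f2: "(\<alpha> - 2) * f t = 0" if t: "t \<in> {0<..<pi}" for t
  proof -
    have "((\<lambda>s. 0) has_real_derivative (\<alpha> - 2) * f t * sin t) (at t)"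
      by (rule has_field_derivative_transform_within_open[OF ds[OF t], of "{0<..<pi}"])
        (use t a in auto)
    then have "(\<alpha> - 2) * f t * sin t = 0" by (metis DERIV_const DERIV_unique)
    then show ?thesis using sin_pos[OF t] by auto
  qed
  have fk: "\<alpha> * (f t)\<^sup>2 + \<kappa> = 0" if t: "t \<in> {0<..<pi}" for t
  proof -
    have "- (\<alpha> * f t * (f t * sin t)) = \<kappa> * sin t"
      using momentum_u[OF t, folded a_def f_def] a[OF t] b[OF t] uw(1)[OF t] by simp
    then have "sin t * (\<alpha> * (f t)\<^sup>2 + \<kappa>) = 0" by (simp add: power2_eq_square algebra_simps)
    then show ?thesis using sin_pos[OF t] by auto
  qed
  \<comment> \<open>A nonzero value forces \<alpha> = 2, and then its square is
    \<open>- \<kappa> / 2\<close>.\<close>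
  have "f t \<in> {0, sqrt (- \<kappa> / 2), - sqrt (- \<kappa> / 2)}" if t: "t \<in> {0<..<pi}" for t
  proof (cases "f t = 0")
    case False
    then have "\<alpha> = 2" using f2[OF t] by simp
    then have "(f t)\<^sup>2 = - \<kappa> / 2" using fk[OF t] by simp
    then have "\<bar>f t\<bar> = sqrt (- \<kappa> / 2)" by (metis real_sqrt_abs)
    then show ?thesis by auto
  qed simp
  then have "f ` {0<..<pi} \<subseteq> {0, sqrt (- \<kappa> / 2), - sqrt (- \<kappa> / 2)}" by blast
  then have "finite (f ` {0<..<pi})" by (rule finite_subset) simp
  moreover have "connected (f ` {0<..<pi})"
  proof (rule connected_continuous_image)
    have "continuous_on {0<..<pi} u" "continuous_on {0<..<pi} w"
      using du dw DERIV_isCont continuous_at_imp_continuous_on by blast+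
    then show "continuous_on {0<..<pi} f" unfolding f_def by (intro continuous_intros)
  qed simp
  ultimately have "f ` {0<..<pi} = {} \<or> (\<exists>c. f ` {0<..<pi} = {c})"
    by (simp add: connected_finite_iff_sing)
  moreover have half: "pi / 2 \<in> {0<..<pi}" by simp
  ultimately obtain c where c: "f ` {0<..<pi} = {c}" by blast
  then have f: "f t = c" if "t \<in> {0<..<pi}" for t using that by blast
  show ?thesis
    by (rule that[of c]) (use f2[OF half] fk[OF half] f[OF half] uw f b in auto)
qed

end

section \<open>From the Euler system to the profile\<close>

lemma differentiable_along_curve:
  fixes W :: "real^3 \<Rightarrow> real^3"
  assumes "(\<gamma> has_vector_derivative \<gamma>') (at s)" "W differentiable (at (\<gamma> s))"
  shows "((\<lambda>s. W (\<gamma> s) $ i) has_real_derivative frechet_derivative W (at (\<gamma> s)) \<gamma>' $ i) (at s)"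
proof -
  let ?D = "frechet_derivative W (at (\<gamma> s))"
  have D: "(W has_derivative ?D) (at (\<gamma> s))" using assms(2) by (simp add: frechet_derivative_works)
  have "((\<lambda>s. W (\<gamma> s)) has_vector_derivative ?D \<gamma>') (at s)"
    using diff_chain_at[OF assms(1)[unfolded has_vector_derivative_def] D]
      linear_simps(5)[OF has_derivative_bounded_linear[OF D]]
    by (simp add: has_vector_derivative_def o_def)
  from bounded_linear.has_vector_derivative[OF bounded_linear_vec_nth this]
  show ?thesis by (simp add: has_real_derivative_iff_has_vector_derivative)
qed

section \<open>Curves on the sphere, cylindrical components, and the derivative of the field\<close>

lemma sph_axes:
  "sph \<phi> \<theta> = (sin \<phi> * cos \<theta>) *\<^sub>R axis 1 1 + (sin \<phi> * sin \<theta>) *\<^sub>R axis 2 1 + cos \<phi> *\<^sub>R axis 3 1"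
  by (simp add: sph_def vec_eq_iff forall_3 axis_def)

lemma norm_sph: "norm (sph \<phi> \<theta>) = 1"
proof -
  have "sph \<phi> \<theta> \<bullet> sph \<phi> \<theta> = (sin \<phi>)\<^sup>2 * ((sin \<theta>)\<^sup>2 + (cos \<theta>)\<^sup>2) + (cos \<phi>)\<^sup>2"
    unfolding sph_def power2_eq_square
    by (simp only: inner_vec_def sum_3 vector_3 inner_real_def) (simp only: algebra_simps)
  then show ?thesis by (simp add: norm_eq_1)
qed

lemma sph_meridian_derivative: "((\<lambda>s. sph s 0) has_vector_derivative e_phi t 0) (at t)"
proof -
  have "((\<lambda>s. sin s *\<^sub>R axis 1 1 + cos s *\<^sub>R axis 3 1 :: real^3) has_vector_derivative
      cos t *\<^sub>R axis 1 1 + (- sin t) *\<^sub>R axis 3 1) (at t)"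
    by (intro has_vector_derivative_add has_vector_derivative_scaleR[OF _ has_vector_derivative_const, simplified]
        DERIV_sin DERIV_cos)
  moreover have "e_phi t 0 = cos t *\<^sub>R axis 1 1 + (- sin t) *\<^sub>R axis 3 1"
    by (simp add: e_phi_def vec_eq_iff forall_3 axis_def)
  ultimately show "((\<lambda>s. sph s 0) has_vector_derivative e_phi t 0) (at t)"
    by (simp add: sph_axes)
qed

text \<open>The vector with radial, azimuthal and axial components \<open>u\<close>,
  \<open>b\<close>, \<open>w\<close> in the cylindrical frame at azimuth \<theta>. At \<theta> = 0
  these are its Cartesian components.\<close>

definition cyl :: "real \<Rightarrow> real \<Rightarrow> real \<Rightarrow> real \<Rightarrow> real^3" where
  "cyl u b w \<theta> = vector [u * cos \<theta> - b * sin \<theta>, u * sin \<theta> + b * cos \<theta>, w]"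

text \<open>At a point of the meridian \<theta> = 0 the derivative of \<open>W\<close> is known on
  an orthogonal basis: homogeneity gives it radially, rotation of the cylindrical frame azimuthally,
  and the profile derivatives give it along the meridian. The Cartesian components of the
  acceleration and the trace are then the four profile equations.\<close>

lemma axisymmetric_profile_of_field:
  fixes W :: "real^3 \<Rightarrow> real^3" and u b w :: "real \<Rightarrow> real"
  assumes W: "\<And>r \<phi> \<theta>. r > 0 \<Longrightarrow> \<phi> \<in> {0<..<pi} \<Longrightarrow>
      W (r *\<^sub>R sph \<phi> \<theta>) = r powr (- \<alpha>) *\<^sub>R cyl (u \<phi>) (b \<phi>) (w \<phi>) \<theta>"
    and diff: "\<And>X. X \<noteq> 0 \<Longrightarrow> W differentiable (at X)"
    and conv: "\<And>X. norm X = 1 \<Longrightarrow> frechet_derivative W (at X) (W X) = \<kappa> *\<^sub>R X"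
    and div: "\<And>X. X \<noteq> 0 \<Longrightarrow> trace (matrix (frechet_derivative W (at X))) = 0"
  shows "\<exists>u' b' w'. axisymmetric_profile \<alpha> \<kappa> u b w u' b' w'"
proof -
  define D where "D t = frechet_derivative W (at (sph t 0))" for t
  have sph0: "sph t 0 \<noteq> 0" for t using norm_sph[of t 0] by auto
  have lin: "linear (D t)" for t
    unfolding D_def using diff[OF sph0] by (rule linear_frechet_derivative)
  have Wsph: "W (sph t \<theta>) = cyl (u t) (b t) (w t) \<theta>" if "t \<in> {0<..<pi}" for t \<theta>
    using W[of 1 t \<theta>] that by simp
  have e_phi: "((\<lambda>s. W (sph s 0) $ i) has_real_derivative D t (e_phi t 0) $ i) (at t)" for t i
  proof -
    from differentiable_along_curve[OF sph_meridian_derivative diff[OF sph0]] show ?thesis unfolding D_def .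
  qed
  \<comment> \<open>Differentiate along the circle of latitude, whose velocity at \<theta> = 0 is
    \<open>sin t\<close> times the second axis.\<close>
  have e_theta: "D t (sin t *\<^sub>R axis 2 1) = vector [- b t, u t, 0]" if t: "t \<in> {0<..<pi}" for t
  proof -
    have "((\<lambda>\<theta>. (sin t * cos \<theta>) *\<^sub>R axis 1 1 + (sin t * sin \<theta>) *\<^sub>R axis 2 1 + cos t *\<^sub>R axis 3 1 :: real^3)
        has_vector_derivative (sin t * - sin 0) *\<^sub>R axis 1 1 + (sin t * cos 0) *\<^sub>R axis 2 1 + 0) (at 0)"
      by (intro has_vector_derivative_add has_vector_derivative_scaleR[OF _ has_vector_derivative_const, simplified]
          has_vector_derivative_const DERIV_sin DERIV_cos DERIV_cmult)
    then have "((\<lambda>\<theta>. sph t \<theta>) has_vector_derivative sin t *\<^sub>R axis 2 1) (at 0)"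
      by (simp add: sph_axes)
    from differentiable_along_curve[OF this diff[OF sph0]]
    have d: "((\<lambda>\<theta>. cyl (u t) (b t) (w t) \<theta> $ i) has_real_derivative D t (sin t *\<^sub>R axis 2 1) $ i) (at 0)"
      for i unfolding D_def Wsph[OF t, symmetric] .
    have "((\<lambda>\<theta>. u t * cos \<theta> - b t * sin \<theta>) has_real_derivative - b t) (at 0)"
      "((\<lambda>\<theta>. u t * sin \<theta> + b t * cos \<theta>) has_real_derivative u t) (at 0)"
      by (auto intro!: derivative_eq_intros)
    with d[of 1] d[of 2] d[of 3] show ?thesis
      by (auto simp: cyl_def vec_eq_iff forall_3 dest: DERIV_unique DERIV_unique[OF _ DERIV_const])
  qed
  \<comment> \<open>Euler's relation for a field homogeneous of degree
    \<open>- \<alpha>\<close>.\<close>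
  have e_r: "D t (sph t 0) = (- \<alpha>) *\<^sub>R vector [u t, b t, w t]" if t: "t \<in> {0<..<pi}" for t
  proof -
    have "((\<lambda>r. r *\<^sub>R sph t 0) has_vector_derivative sph t 0) (at 1)"
      using has_vector_derivative_scaleR[OF DERIV_ident has_vector_derivative_const] by simp
    from differentiable_along_curve[OF this]
    have "((\<lambda>r. W (r *\<^sub>R sph t 0) $ i) has_real_derivative D t (sph t 0) $ i) (at 1)" for i
      using diff[OF sph0] by (simp add: D_def)
    then have d: "((\<lambda>r. r powr (- \<alpha>) * cyl (u t) (b t) (w t) 0 $ i) has_real_derivative D t (sph t 0) $ i) (at 1)"
      for i
      by (rule has_field_derivative_transform_within_open[of _ _ _ "{0<..}"]) (auto simp: W[OF _ t])
    have "((\<lambda>r. r powr (- \<alpha>) * c) has_real_derivative - \<alpha> * c) (at 1)" for c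
      by (auto intro!: derivative_eq_intros)
    from DERIV_unique[OF d this] show ?thesis by (simp add: cyl_def vec_eq_iff forall_3)
  qed
  show ?thesis
  \<comment> \<open>The witnesses stay open here; the first three goals fix them as the components
    of \<open>D t (e_phi t 0)\<close>.\<close>
  proof (intro exI axisymmetric_profile.intro)
    fix t :: real assume t: "t \<in> {0<..<pi}"
    let ?a = "cos t * u t - sin t * w t" and ?f = "sin t * u t + cos t * w t"
    have s: "sin t > 0" using t by (simp add: sin_gt_zero)
    have d: "((\<lambda>s. cyl (u s) (b s) (w s) 0 $ i) has_real_derivative D t (e_phi t 0) $ i) (at t)" for i
      by (rule has_field_derivative_transform_within_open[OF e_phi, of "{0<..<pi}"]) (use t in \<open>auto simp: Wsph\<close>)
    show "(u has_real_derivative D t (e_phi t 0) $ 1) (at t)"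
      "(b has_real_derivative D t (e_phi t 0) $ 2) (at t)"
      "(w has_real_derivative D t (e_phi t 0) $ 3) (at t)"
      using d[of 1] d[of 2] d[of 3] by (simp_all add: cyl_def)
    have "D t (axis 2 1) = (1 / sin t) *\<^sub>R D t (sin t *\<^sub>R axis 2 1)"
      using s by (simp add: linear_scale[OF lin])
    then have e2: "D t (axis 2 1) = (1 / sin t) *\<^sub>R vector [- b t, u t, 0]" using e_theta[OF t] by simp
    have "W (sph t 0) = ?a *\<^sub>R e_phi t 0 + ?f *\<^sub>R sph t 0 + b t *\<^sub>R axis 2 1"
    proof -
      have "?a * cos t + ?f * sin t = u t * ((sin t)\<^sup>2 + (cos t)\<^sup>2)"
        "?f * cos t - ?a * sin t = w t * ((sin t)\<^sup>2 + (cos t)\<^sup>2)"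
        unfolding power2_eq_square by (simp_all only: algebra_simps)
      then show ?thesis
        unfolding Wsph[OF t] by (simp add: cyl_def sph_def e_phi_def vec_eq_iff forall_3 axis_def)
    qed
    then have "D t (W (sph t 0)) = ?a *\<^sub>R D t (e_phi t 0) + ?f *\<^sub>R D t (sph t 0) + b t *\<^sub>R D t (axis 2 1)"
      by (simp only: linear_add[OF lin] linear_scale[OF lin])
    then have c: "\<kappa> *\<^sub>R sph t 0 = ?a *\<^sub>R D t (e_phi t 0)
        + ?f *\<^sub>R ((- \<alpha>) *\<^sub>R vector [u t, b t, w t]) + b t *\<^sub>R ((1 / sin t) *\<^sub>R vector [- b t, u t, 0])"
      unfolding e_r[OF t] e2 using conv[OF norm_sph, of t 0] by (simp only: D_def)
    show "?a * D t (e_phi t 0) $ 1 - (b t)\<^sup>2 / sin t - \<alpha> * ?f * u t = \<kappa> * sin t"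
      using arg_cong[OF c, of "\<lambda>x. x $ 1"] by (simp add: sph_def power2_eq_square mult_ac)
    show "?a * D t (e_phi t 0) $ 2 + b t * u t / sin t - \<alpha> * ?f * b t = 0"
      using arg_cong[OF c, of "\<lambda>x. x $ 2"] by (simp add: sph_def mult_ac)
    show "?a * D t (e_phi t 0) $ 3 - \<alpha> * ?f * w t = \<kappa> * cos t"
      using arg_cong[OF c, of "\<lambda>x. x $ 3"] by (simp add: sph_def mult_ac)
    have sc: "sin t * sin t + cos t * cos t = 1" using sin_cos_squared_add[of t] by (simp only: power2_eq_square)
    \<comment> \<open>The trace is taken in Cartesian axes. The first and third lie in the meridian
      plane and are expressed through the spherical frame; the second is the azimuthal
      direction.\<close>
    have "(axis 1 1 :: real^3) = sin t *\<^sub>R sph t 0 + cos t *\<^sub>R e_phi t 0"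
      "(axis 3 1 :: real^3) = cos t *\<^sub>R sph t 0 - sin t *\<^sub>R e_phi t 0"
      using sc by (simp_all add: sph_def e_phi_def vec_eq_iff forall_3 axis_def add.commute)
    then have e13: "D t (axis 1 1) = sin t *\<^sub>R D t (sph t 0) + cos t *\<^sub>R D t (e_phi t 0)"
      "D t (axis 3 1) = cos t *\<^sub>R D t (sph t 0) - sin t *\<^sub>R D t (e_phi t 0)"
      by (simp_all only: linear_add[OF lin] linear_diff[OF lin] linear_scale[OF lin])
    have "D t (axis 1 1) $ 1 + D t (axis 2 1) $ 2 + D t (axis 3 1) $ 3 = 0"
      using div[OF sph0, of t] by (simp add: trace_def matrix_def sum_3 D_def)
    then show "cos t * D t (e_phi t 0) $ 1 - sin t * D t (e_phi t 0) $ 3 + u t / sin t - \<alpha> * ?f = 0"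
      unfolding e13 e2 e_r[OF t] by (simp add: algebra_simps)
  qed
qed

text \<open>A pressure constant on the sphere depends on the radius alone, so its gradient is
  radial. On the unit sphere this supplies the parameter \<kappa>, and it also makes the
  acceleration parallel to \<open>X\<close>.\<close>

lemma gradient_hom_pressure_const:
  assumes p: "\<And>n. n \<in> sphere 0 1 \<Longrightarrow> p n = c" and X: "X \<noteq> 0"
  shows "gradient (hom_pressure \<alpha> p) X = (- 2 * \<alpha> * c * norm X powr (- 2 * \<alpha> - 2)) *\<^sub>R X"
proof -
  have "((\<lambda>r. c * r powr (- 2 * \<alpha>)) has_real_derivative
      c * (- 2 * \<alpha> * norm X powr (- 2 * \<alpha> - 1))) (at (norm X))"
    using X by (intro DERIV_cmult has_real_derivative_powr) simp
  from DERIV_compose_FDERIV[OF this has_derivative_norm[OF X]]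
  have "((\<lambda>X. c * norm X powr (- 2 * \<alpha>)) has_derivative
      (\<lambda>h. h \<bullet> sgn X * (c * (- 2 * \<alpha> * norm X powr (- 2 * \<alpha> - 1))))) (at X)" .
  then have "(hom_pressure \<alpha> p has_derivative
      (\<lambda>h. h \<bullet> sgn X * (c * (- 2 * \<alpha> * norm X powr (- 2 * \<alpha> - 1))))) (at X)"
    by (rule has_derivative_transform_within_open[where s = "- {0}"])
      (use X p in \<open>auto simp: hom_pressure_def norm_sgn powr_minus field_simps\<close>)
  note fd = frechet_derivative_at[OF this, symmetric]
  have "gradient (hom_pressure \<alpha> p) X
      = (c * (- 2 * \<alpha> * norm X powr (- 2 * \<alpha> - 1))) *\<^sub>R sgn X"
    unfolding gradient_def fd by (simp add: vec_eq_iff inner_axis' mult.commute)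
  also have "\<dots> = (- 2 * \<alpha> * c * (norm X powr (- 2 * \<alpha> - 1) / norm X)) *\<^sub>R X"
    by (simp add: sgn_div_norm field_simps)
  also have "norm X powr (- 2 * \<alpha> - 1) / norm X = norm X powr (- 2 * \<alpha> - 2)"
  proof -
    have e: "- 2 * \<alpha> - 2 = (- 2 * \<alpha> - 1) - 1" by simp
    show ?thesis unfolding e powr_diff[of _ "- 2 * \<alpha> - 1" 1] using X by simp
  qed
  finally show ?thesis .
qed

section \<open>Coordinates off the axis, extension to the axis, and the family in spherical
  form\<close>

lemma spherical_coordinates:
  fixes X :: "real^3"
  assumes X: "(X$1)\<^sup>2 + (X$2)\<^sup>2 > 0"
  obtains r \<phi> \<theta> where "r > 0" "\<phi> \<in> {0<..<pi}" "X = r *\<^sub>R sph \<phi> \<theta>"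
proof -
  define r where "r = norm X"
  define \<rho> where "\<rho> = sqrt ((X$1)\<^sup>2 + (X$2)\<^sup>2)"
  have r2: "r\<^sup>2 = (X$1)\<^sup>2 + (X$2)\<^sup>2 + (X$3)\<^sup>2"
    unfolding r_def power2_norm_eq_inner by (simp add: inner_vec_def sum_3 power2_eq_square)
  have "X \<noteq> 0" using X by auto
  then have r: "r > 0" by (simp add: r_def)
  have \<rho>: "\<rho> > 0" "\<rho>\<^sup>2 = (X$1)\<^sup>2 + (X$2)\<^sup>2" using X by (auto simp: \<rho>_def)
  have "(X$3 / r)\<^sup>2 + (\<rho> / r)\<^sup>2 = 1"
  proof -
    have "(X$3)\<^sup>2 + \<rho>\<^sup>2 = r\<^sup>2" using r2 \<rho> by simp
    then show ?thesis using r by (simp only: power_divide add_divide_distrib[symmetric]) simp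
  qed
  moreover have "\<rho> / r > 0" using r \<rho> by simp
  ultimately obtain \<phi> where \<phi>: "0 \<le> \<phi>" "\<phi> \<le> pi" "X$3 / r = cos \<phi>" "\<rho> / r = sin \<phi>"
    using sincos_total_pi[of "\<rho> / r" "X$3 / r"] by auto
  then have "\<phi> \<noteq> 0" "\<phi> \<noteq> pi" using \<open>\<rho> / r > 0\<close> by auto
  have "(X$1 / \<rho>)\<^sup>2 + (X$2 / \<rho>)\<^sup>2 = 1"
    using \<rho>(1) by (simp only: power_divide add_divide_distrib[symmetric] \<rho>(2)[symmetric]) simp
  then obtain \<theta> where \<theta>: "X$1 / \<rho> = cos \<theta>" "X$2 / \<rho> = sin \<theta>"
    using sincos_total_2pi by blast
  have "X$1 = \<rho> * cos \<theta>" "X$2 = \<rho> * sin \<theta>" "X$3 = r * cos \<phi>" "\<rho> = r * sin \<phi>"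
    using r \<rho>(1) by (simp_all flip: \<theta> \<phi>(3,4))
  then have "X = r *\<^sub>R sph \<phi> \<theta>" by (simp add: sph_def vec_eq_iff forall_3)
  then show ?thesis using that[of r \<phi> \<theta>] r \<phi> \<open>\<phi> \<noteq> 0\<close> \<open>\<phi> \<noteq> pi\<close> by simp
qed

lemma sph_off_axis:
  assumes "r > 0" "\<phi> \<in> {0<..<pi}"
  shows "((r *\<^sub>R sph \<phi> \<theta>)$1)\<^sup>2 + ((r *\<^sub>R sph \<phi> \<theta>)$2)\<^sup>2 = (r * sin \<phi>)\<^sup>2"
proof -
  have "((r *\<^sub>R sph \<phi> \<theta>)$1)\<^sup>2 + ((r *\<^sub>R sph \<phi> \<theta>)$2)\<^sup>2 = (r * sin \<phi>)\<^sup>2 * ((sin \<theta>)\<^sup>2 + (cos \<theta>)\<^sup>2)"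
    unfolding sph_def by (simp only: vector_3 vector_scaleR_component real_scaleR_def power2_eq_square algebra_simps)
  then show ?thesis by simp
qed

text \<open>A nonzero point of the axis is the limit of points shifted along the first coordinate
  direction, where the two fields agree.\<close>

lemma eq_off_axis_imp_eq:
  fixes F G :: "real^3 \<Rightarrow> real^3"
  assumes F: "continuous_on (- {0}) F" and G: "continuous_on (- {0}) G"
    and eq: "\<And>X. (X$1)\<^sup>2 + (X$2)\<^sup>2 > 0 \<Longrightarrow> F X = G X" and X: "X \<noteq> 0"
  shows "F X = G X"
proof (cases "(X$1)\<^sup>2 + (X$2)\<^sup>2 > 0")
  case False
  then have z: "X$1 = 0" "X$2 = 0" by (auto simp: sum_power2_gt_zero_iff)
  have lim: "((\<lambda>t. H (X + t *\<^sub>R axis 1 1)) \<longlongrightarrow> H X) (at (0::real))"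
    if "continuous_on (- {0}) H" for H :: "real^3 \<Rightarrow> real^3"
  proof -
    have "isCont H X" using that X by (simp add: continuous_on_eq_continuous_at open_Compl)
    then show ?thesis by (rule isCont_tendsto_compose) (auto intro!: tendsto_eq_intros)
  qed
  have "F (X + t *\<^sub>R axis 1 1) = G (X + t *\<^sub>R axis 1 1)" if "t \<noteq> 0" for t
    using that z by (intro eq) (simp add: axis_def)
  then have "eventually (\<lambda>t. F (X + t *\<^sub>R axis 1 1) = G (X + t *\<^sub>R axis 1 1)) (at (0::real))"
    by (simp add: eventually_at_filter)
  then have "((\<lambda>t. G (X + t *\<^sub>R axis 1 1)) \<longlongrightarrow> F X) (at (0::real))"
    by (rule Lim_transform_eventually[OF lim[OF F]])
  then show ?thesis using tendsto_unique[OF at_neq_bot _ lim[OF G]] by blast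
qed (rule eq)

lemma spherical_frame_eq_cyl:
  "a *\<^sub>R e_phi \<phi> \<theta> + b *\<^sub>R e_theta \<phi> \<theta> + f *\<^sub>R sph \<phi> \<theta>
    = cyl (a * cos \<phi> + f * sin \<phi>) b (f * cos \<phi> - a * sin \<phi>) \<theta>"
  by (simp add: cyl_def sph_def e_phi_def e_theta_def vec_eq_iff forall_3 algebra_simps)

lemma cyl_zero: "cyl 0 0 0 \<theta> = 0"
  by (simp add: cyl_def vec_eq_iff forall_3)

lemma cyl_radial: "cyl (c * sin \<phi>) 0 (c * cos \<phi>) \<theta> = c *\<^sub>R sph \<phi> \<theta>"
  by (simp add: cyl_def sph_def vec_eq_iff forall_3)

lemma hom_velocity_scaleR:
  assumes "r > 0"
  shows "hom_velocity \<alpha> v f (r *\<^sub>R X) = r powr (- \<alpha>) *\<^sub>R hom_velocity \<alpha> v f X"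
  using assms by (simp add: hom_velocity_def sgn_scaleR powr_mult powr_minus)

text \<open>Here \<open>K\<close> is \<open>M\<close> times the square of
  \<open>a\<^sub>0 * r\<close>. The factors \<open>a\<^sub>0\<close> in front and those from the
  powers of \<open>K\<close> combine to \<open>a\<^sub>0 powr (2 - \<alpha>)\<close> in all
  components. The minus sign in \<open>- k * a\<^sub>0\<close> matches the orientation of the swirl,
  whose azimuthal part in the family carries \<open>- b\<^sub>0\<close>.\<close>

lemma family_field_spherical:
  fixes k :: real
  assumes r: "r > 0" and \<phi>: "\<phi> \<in> {0<..<pi}" and a0: "a\<^sub>0 > 0"
  defines "M \<equiv> (sin \<phi>)\<^sup>2 - k\<^sup>2 * (cos \<phi>)\<^sup>2"
  shows "family_field \<alpha> a\<^sub>0 (- k * a\<^sub>0) (r *\<^sub>R sph \<phi> \<theta>) =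
    (if M > 0 then (a\<^sub>0 powr (2 - \<alpha>) * r powr (- \<alpha>)) *\<^sub>R
        cyl (k\<^sup>2 * M powr (- \<alpha> / 2) * cos \<phi> / sin \<phi>) (k * M powr ((1 - \<alpha>) / 2) / sin \<phi>)
          (M powr (- \<alpha> / 2)) \<theta>
     else 0)"
proof -
  let ?X = "r *\<^sub>R sph \<phi> \<theta>"
  have s: "sin \<phi> > 0" using \<phi> by (simp add: sin_gt_zero)
  have X: "?X$1 = r * sin \<phi> * cos \<theta>" "?X$2 = r * sin \<phi> * sin \<theta>" "?X$3 = r * cos \<phi>"
    by (simp_all add: sph_def)
  have R: "(?X$1)\<^sup>2 + (?X$2)\<^sup>2 = (r * sin \<phi>)\<^sup>2" using sph_off_axis[OF r \<phi>] .
  have d: "a\<^sub>0\<^sup>2 * (r * sin \<phi>)\<^sup>2 - (- k * a\<^sub>0)\<^sup>2 * (r * cos \<phi>)\<^sup>2 = (a\<^sub>0 * r)\<^sup>2 * M"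
    by (simp add: M_def power_mult_distrib algebra_simps)
  have K: "K a\<^sub>0 (- k * a\<^sub>0) ?X = (if M > 0 then (a\<^sub>0 * r)\<^sup>2 * M else 0)"
  proof -
    have "0 \<le> (a\<^sub>0 * r)\<^sup>2 * M \<longleftrightarrow> 0 \<le> M" using r a0 by (simp add: zero_le_mult_iff)
    then have "(- k * a\<^sub>0)\<^sup>2 * (r * cos \<phi>)\<^sup>2 \<le> a\<^sub>0\<^sup>2 * (r * sin \<phi>)\<^sup>2 \<longleftrightarrow> 0 \<le> M"
      unfolding d[symmetric] by simp
    then show ?thesis using d unfolding K_def Let_def R unfolding X by auto
  qed
  show ?thesis
  proof (cases "M > 0")
    case False
    \<comment> \<open>With \<open>K\<close> zero every component vanishes, since
      \<open>0 powr e\<close> is 0 for every exponent, including 0 and negative ones.\<close>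
    then show ?thesis unfolding family_field_def Let_def K by (simp add: vec_eq_iff forall_3)
  next
    case True
    have Kp: "((a\<^sub>0 * r)\<^sup>2 * M) powr (e / 2) = a\<^sub>0 powr e * r powr e * M powr (e / 2)" for e
    proof -
      have "((a\<^sub>0 * r)\<^sup>2) powr (e / 2) = (a\<^sub>0 * r) powr e"
        using a0 r by (simp add: powr_powr flip: powr_numeral)
      then show ?thesis using a0 r True by (simp add: powr_mult)
    qed
    have p: "a\<^sub>0\<^sup>2 * a\<^sub>0 powr (- \<alpha>) = a\<^sub>0 powr (2 - \<alpha>)" "a\<^sub>0 * a\<^sub>0 powr (1 - \<alpha>) = a\<^sub>0 powr (2 - \<alpha>)"
      "r powr (1 - \<alpha>) = r * r powr (- \<alpha>)"
      using a0 r by (simp_all add: powr_mult_base powr_diff powr_minus power2_eq_square field_simps)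
    define A Q where "A = a\<^sub>0 powr (2 - \<alpha>)" and "Q = r powr (- \<alpha>)"
    have 1: "(- k * a\<^sub>0)\<^sup>2 * (r * sin \<phi> * c * (r * cos \<phi>) / (r * sin \<phi>)\<^sup>2) * (a\<^sub>0 powr (- \<alpha>) * r powr (- \<alpha>) * m)
        = A * Q * (k\<^sup>2 * m * cos \<phi> / sin \<phi> * c)" for c m
      unfolding A_def Q_def p(1)[symmetric] using r s by (simp add: power2_eq_square)
    have 2: "- k * a\<^sub>0 * (r * sin \<phi> * c / (r * sin \<phi>)\<^sup>2) * (a\<^sub>0 powr (1 - \<alpha>) * r powr (1 - \<alpha>) * m)
        = - (A * Q * (k * m / sin \<phi> * c))" for c m
      unfolding A_def Q_def p(2)[symmetric] p(3) using r s by (simp add: power2_eq_square)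
    have 3: "a\<^sub>0\<^sup>2 * (a\<^sub>0 powr (- \<alpha>) * r powr (- \<alpha>) * m) = A * Q * m" for m
      unfolding A_def Q_def p(1)[symmetric] by simp
    have F: "family_field \<alpha> a\<^sub>0 (- k * a\<^sub>0) ?X = vector
      [A * Q * (k\<^sup>2 * M powr (- \<alpha> / 2) * cos \<phi> / sin \<phi> * cos \<theta>)
         + - (A * Q * (k * M powr ((1 - \<alpha>) / 2) / sin \<phi> * sin \<theta>)),
       A * Q * (k\<^sup>2 * M powr (- \<alpha> / 2) * cos \<phi> / sin \<phi> * sin \<theta>)
         - - (A * Q * (k * M powr ((1 - \<alpha>) / 2) / sin \<phi> * cos \<theta>)),
       A * Q * M powr (- \<alpha> / 2)]"
      unfolding family_field_def Let_def R K if_P[OF True] Kp unfolding X 1 2 3 ..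
    show ?thesis
      unfolding F if_P[OF True] A_def[symmetric] Q_def[symmetric]
      by (simp add: cyl_def vec_eq_iff forall_3 right_diff_distrib distrib_left)
  qed
qed

section \<open>Rotation to coordinates adapted to the axis of symmetry\<close>

lemma has_derivative_conjugate:
  fixes V :: "real^3 \<Rightarrow> real^3" and A B :: "real^3^3"
  assumes "V differentiable (at (B *v X))"
  shows "((\<lambda>X. A *v V (B *v X)) has_derivative
    (\<lambda>h. A *v frechet_derivative V (at (B *v X)) (B *v h))) (at X)"
proof -
  have "((\<lambda>X. B *v X) has_derivative (\<lambda>h. B *v h)) (at X)"
    by (rule bounded_linear_imp_has_derivative[OF matrix_vector_mul_bounded_linear])
  from diff_chain_at[OF this assms[unfolded frechet_derivative_works]]
  have "((\<lambda>X. V (B *v X)) has_derivative (\<lambda>h. frechet_derivative V (at (B *v X)) (B *v h))) (at X)"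
    by (simp add: o_def)
  from bounded_linear.has_derivative[OF matrix_vector_mul_bounded_linear this] show ?thesis .
qed

text \<open>Cyclic invariance of the trace; it carries the divergence condition to the rotated
  field.\<close>

lemma trace_conjugate:
  fixes D :: "real^3 \<Rightarrow> real^3" and R :: "real^3^3"
  assumes "orthogonal_matrix R" "linear D"
  shows "trace (matrix (\<lambda>h. transpose R *v D (R *v h))) = trace (matrix D)"
proof -
  have "D h = matrix D *v h" for h using matrix_works[of D] assms(2) by (simp add: linear_matrix_vector_mul_eq)
  then have "(\<lambda>h. transpose R *v D (R *v h)) = (\<lambda>h. (transpose R ** (matrix D ** R)) *v h)"
    by (simp add: matrix_vector_mul_assoc fun_eq_iff del: transpose_matrix_vector)
  then have "trace (matrix (\<lambda>h. transpose R *v D (R *v h))) = trace ((matrix D ** R) ** transpose R)"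
    by (simp add: matrix_of_matrix_vector_mul trace_mul_sym[of "transpose R"])
  also have "(matrix D ** R) ** transpose R = matrix D"
    using assms(1) by (simp add: orthogonal_matrix_def flip: matrix_mul_assoc)
  finally show ?thesis .
qed

text \<open>Conjugation by the rotation makes the third coordinate axis the axis of symmetry. It
  preserves the divergence, and an acceleration that is a multiple of \<open>X\<close> by a function
  of its norm keeps this form.\<close>

lemma rotated_profile:
  assumes sol: "C1_solution \<alpha> v f p" and R: "rotation_matrix R" and ax: "axisymmetric_in R v f p"
    and p: "\<And>n. n \<in> sphere 0 1 \<Longrightarrow> p n = c"
  obtains u b w u' b' w' where "axisymmetric_profile \<alpha> (2 * \<alpha> * c) u b w u' b' w'"
    "\<And>r \<phi> \<theta>. r > 0 \<Longrightarrow> \<phi> \<in> {0<..<pi} \<Longrightarrow>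
      hom_velocity \<alpha> v f (R *v (r *\<^sub>R sph \<phi> \<theta>)) = r powr (- \<alpha>) *\<^sub>R (R *v cyl (u \<phi>) (b \<phi>) (w \<phi>) \<theta>)"
proof -
  let ?V = "hom_velocity \<alpha> v f"
  define W where "W X = transpose R *v ?V (R *v X)" for X
  have oR: "orthogonal_matrix R" using R by (simp add: rotation_matrix_def)
  have TR: "transpose R *v (R *v X) = X" and RT: "R *v (transpose R *v X) = X" for X
    using oR by (simp_all add: matrix_vector_mul_assoc orthogonal_matrix_def del: transpose_matrix_vector)
  have nR: "norm (R *v X) = norm X" for X
    using oR orthogonal_transformation_matrix[of "(*v) R"] by (simp add: orthogonal_transformation_norm)
  have R0: "R *v X \<noteq> 0" if "X \<noteq> 0" for X using that nR[of X] by auto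
  have E: "?V differentiable (at X)" "convective ?V X = - gradient (hom_pressure \<alpha> p) X" "divergence ?V X = 0"
    if "X \<noteq> 0" for X
    using sol that by (auto simp: C1_solution_def stationary_Euler_on_def eq_neg_iff_add_eq_0)
  obtain a b f\<^sub>0 where af: "\<And>\<phi> \<theta>. \<phi> \<in> {0<..<pi} \<Longrightarrow>
      v (R *v sph \<phi> \<theta>) = a \<phi> *\<^sub>R (R *v e_phi \<phi> \<theta>) + b \<phi> *\<^sub>R (R *v e_theta \<phi> \<theta>) \<and> f (R *v sph \<phi> \<theta>) = f\<^sub>0 \<phi>"
    using ax unfolding axisymmetric_in_def by metis
  define u where "u \<phi> = a \<phi> * cos \<phi> + f\<^sub>0 \<phi> * sin \<phi>" for \<phi>
  define w where "w \<phi> = f\<^sub>0 \<phi> * cos \<phi> - a \<phi> * sin \<phi>" for \<phi>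
  have Wsph: "W (r *\<^sub>R sph \<phi> \<theta>) = r powr (- \<alpha>) *\<^sub>R cyl (u \<phi>) (b \<phi>) (w \<phi>) \<theta>"
    if r: "r > 0" and \<phi>: "\<phi> \<in> {0<..<pi}" for r \<phi> \<theta>
  proof -
    have n: "norm (R *v sph \<phi> \<theta>) = 1" by (simp add: nR norm_sph)
    then have "?V (R *v sph \<phi> \<theta>) = R *v cyl (u \<phi>) (b \<phi>) (w \<phi>) \<theta>"
      using af[OF \<phi>, of \<theta>]
      by (simp add: hom_velocity_def sgn_div_norm u_def w_def matrix_vector_right_distrib matrix_vector_mult_scaleR
          flip: spherical_frame_eq_cyl)
    then show ?thesis
      by (simp add: W_def hom_velocity_scaleR[OF r] matrix_vector_mult_scaleR TR
          del: transpose_matrix_vector)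
  qed
  have dW: "(W has_derivative (\<lambda>h. transpose R *v frechet_derivative ?V (at (R *v X)) (R *v h))) (at X)"
    if "X \<noteq> 0" for X
    unfolding W_def by (rule has_derivative_conjugate[OF E(1)[OF R0[OF that]]])
  note fW = frechet_derivative_at[OF dW, symmetric]
  have "\<exists>u' b' w'. axisymmetric_profile \<alpha> (2 * \<alpha> * c) u b w u' b' w'"
  proof (rule axisymmetric_profile_of_field[of W])
    fix X :: "real^3"
    show "W differentiable (at X)" if "X \<noteq> 0" using dW[OF that] by (auto simp: differentiable_def)
    show "trace (matrix (frechet_derivative W (at X))) = 0" if X: "X \<noteq> 0"
      using E(3)[OF R0[OF X]] trace_conjugate[OF oR linear_frechet_derivative[OF E(1)[OF R0[OF X]]]]
      by (simp add: fW[OF X] divergence_def jacobian_def del: transpose_matrix_vector)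
    show "frechet_derivative W (at X) (W X) = (2 * \<alpha> * c) *\<^sub>R X" if X1: "norm X = 1"
    proof -
      have X: "X \<noteq> 0" using X1 by auto
      have "frechet_derivative W (at X) (W X) = transpose R *v convective ?V (R *v X)"
        by (simp add: fW[OF X] W_def RT convective_def del: transpose_matrix_vector)
      also have "convective ?V (R *v X) = (2 * \<alpha> * c) *\<^sub>R (R *v X)"
        using E(2)[OF R0[OF X]] gradient_hom_pressure_const[of p c "R *v X" \<alpha>] p R0[OF X] X1
        by (simp add: nR)
      finally show ?thesis by (simp add: matrix_vector_mult_scaleR TR del: transpose_matrix_vector)
    qed
  qed (rule Wsph)
  then obtain u' b' w' where "axisymmetric_profile \<alpha> (2 * \<alpha> * c) u b w u' b' w'" by blast
  then show ?thesis
  proof (rule that)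
    fix r \<phi> \<theta> :: real assume "r > 0" "\<phi> \<in> {0<..<pi}"
    from arg_cong[OF Wsph[OF this, of \<theta>], of "\<lambda>X. R *v X"]
    show "?V (R *v (r *\<^sub>R sph \<phi> \<theta>)) = r powr (- \<alpha>) *\<^sub>R (R *v cyl (u \<phi>) (b \<phi>) (w \<phi>) \<theta>)"
      by (simp add: W_def RT matrix_vector_mult_scaleR del: transpose_matrix_vector)
  qed
qed

section \<open>Classification of the solutions\<close>

lemma cyl_scaleR: "cyl (c * u) (c * b) (c * w) \<theta> = c *\<^sub>R cyl u b w \<theta>"
  by (simp add: cyl_def vec_eq_iff forall_3 algebra_simps)

text \<open>The curve \<open>sph s 0\<close> passes smoothly through the pole at
  \<open>s = 0\<close>. Differentiability of the field there applies the exponent criterion to a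
  power of the sine, which has a simple zero. The exponent 0 survives, as for a uniform
  flow.\<close>

lemma swirl_free_exponent:
  fixes V :: "real^3 \<Rightarrow> real^3" and R :: "real^3^3"
  assumes V: "V differentiable (at (R *v sph 0 0))" and R: "orthogonal_matrix R" and w1: "w\<^sub>1 \<noteq> 0"
    and axial: "\<And>s. s \<in> {0<..<pi} \<Longrightarrow> V (R *v sph s 0) = R *v cyl (u s) (b s) (w\<^sub>1 * sin s powr (- \<alpha>)) 0"
  shows "\<alpha> = 0 \<or> \<alpha> \<le> -1"
proof -
  define W where "W X = transpose R *v V (R *v X)" for X
  have TR: "transpose R *v (R *v X) = X" for X
    using R by (simp add: matrix_vector_mul_assoc orthogonal_matrix_def del: transpose_matrix_vector)
  have "W differentiable (at (sph 0 0))"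
    using has_derivative_conjugate[OF V] unfolding W_def differentiable_def by blast
  from differentiable_along_curve[OF sph_meridian_derivative this, of 3]
  obtain g' where g: "((\<lambda>s. W (sph s 0) $ 3) has_real_derivative g') (at 0)" by blast
  have "W (sph s 0) $ 3 = w\<^sub>1 * sin s powr (- \<alpha>)" if "s \<in> {0<..<pi}" for s
    unfolding W_def axial[OF that] TR by (simp add: cyl_def)
  then have "- \<alpha> = 0 \<and> W (sph 0 0) $ 3 = w\<^sub>1 \<or> 1 \<le> - \<alpha>"
    by (intro differentiable_power_exponent[OF g DERIV_sin _ _ w1 pi_gt_zero]) (auto intro: sin_gt_zero)
  then show ?thesis by auto
qed

text \<open>Both fields are compared in spherical coordinates off the axis. Any positive
  \<open>a\<^sub>0\<close> works, since only the ratio \<open>- k\<close> of the two family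
  parameters is determined by the profile; scaling is absorbed in the constant.\<close>

lemma family_member_of_profile:
  fixes V :: "real^3 \<Rightarrow> real^3" and R :: "real^3^3" and w\<^sub>1 l\<^sub>1 :: real
  defines "k \<equiv> l\<^sub>1 / w\<^sub>1"
  defines "M \<equiv> \<lambda>\<phi>. (sin \<phi>)\<^sup>2 - k\<^sup>2 * (cos \<phi>)\<^sup>2"
  assumes cont: "continuous_on (- {0}) V" and w1: "w\<^sub>1 \<noteq> 0"
    and V: "\<And>r \<phi> \<theta>. r > 0 \<Longrightarrow> \<phi> \<in> {0<..<pi} \<Longrightarrow>
      V (R *v (r *\<^sub>R sph \<phi> \<theta>)) = r powr (- \<alpha>) *\<^sub>R (R *v cyl (u \<phi>) (b \<phi>) (w \<phi>) \<theta>)"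
    and pos: "\<And>\<phi>. \<lbrakk>\<phi> \<in> {0<..<pi}; M \<phi> > 0\<rbrakk> \<Longrightarrow> w \<phi> = w\<^sub>1 * M \<phi> powr (- \<alpha> / 2) \<and>
      b \<phi> * sin \<phi> = l\<^sub>1 * M \<phi> powr ((1 - \<alpha>) / 2) \<and>
      u \<phi> * sin \<phi> = l\<^sub>1\<^sup>2 / w\<^sub>1 * M \<phi> powr (- \<alpha> / 2) * cos \<phi>"
    and nonpos: "\<And>\<phi>. \<lbrakk>\<phi> \<in> {0<..<pi}; M \<phi> \<le> 0\<rbrakk> \<Longrightarrow> u \<phi> = 0 \<and> b \<phi> = 0 \<and> w \<phi> = 0"
    and a0: "a\<^sub>0 > 0"
  shows "is_family_member R \<alpha> a\<^sub>0 (- k * a\<^sub>0) V"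
  unfolding is_family_member_def
proof (intro conjI exI allI impI cont)
  \<comment> \<open>The power of \<open>a\<^sub>0\<close> undoes the factor produced by
    \<open>family_field_spherical\<close>.\<close>
  let ?c = "w\<^sub>1 * a\<^sub>0 powr (\<alpha> - 2)"
  show "?c \<noteq> 0" using w1 a0 by simp
  fix X :: "real^3" assume "(X$1)\<^sup>2 + (X$2)\<^sup>2 > 0"
  then obtain r \<phi> \<theta> where r: "r > 0" and \<phi>: "\<phi> \<in> {0<..<pi}" and X: "X = r *\<^sub>R sph \<phi> \<theta>"
    by (rule spherical_coordinates)
  have s: "sin \<phi> > 0" using \<phi> by (simp add: sin_gt_zero)
  have ff: "family_field \<alpha> a\<^sub>0 (- k * a\<^sub>0) X =
    (if M \<phi> > 0 then (a\<^sub>0 powr (2 - \<alpha>) * r powr (- \<alpha>)) *\<^sub>R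
        cyl (k\<^sup>2 * M \<phi> powr (- \<alpha> / 2) * cos \<phi> / sin \<phi>) (k * M \<phi> powr ((1 - \<alpha>) / 2) / sin \<phi>)
          (M \<phi> powr (- \<alpha> / 2)) \<theta>
     else 0)"
    unfolding X M_def by (rule family_field_spherical[OF r \<phi> a0])
  show "V (R *v X) = ?c *\<^sub>R (R *v family_field \<alpha> a\<^sub>0 (- k * a\<^sub>0) X)"
  proof (cases "M \<phi> > 0")
    case False
    then show ?thesis
      unfolding ff using nonpos[OF \<phi>] by (simp add: X V[OF r \<phi>] cyl_zero)
  next
    case True
    have "u \<phi> = w\<^sub>1 * (k\<^sup>2 * M \<phi> powr (- \<alpha> / 2) * cos \<phi> / sin \<phi>)"
      "b \<phi> = w\<^sub>1 * (k * M \<phi> powr ((1 - \<alpha>) / 2) / sin \<phi>)" "w \<phi> = w\<^sub>1 * M \<phi> powr (- \<alpha> / 2)"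
      using pos[OF \<phi> True] s w1 by (simp_all add: k_def power2_eq_square field_simps)
    then have cyl: "cyl (u \<phi>) (b \<phi>) (w \<phi>) \<theta> = w\<^sub>1 *\<^sub>R
        cyl (k\<^sup>2 * M \<phi> powr (- \<alpha> / 2) * cos \<phi> / sin \<phi>) (k * M \<phi> powr ((1 - \<alpha>) / 2) / sin \<phi>)
          (M \<phi> powr (- \<alpha> / 2)) \<theta>"
      by (simp only: cyl_scaleR)
    have "V (R *v X) = (w\<^sub>1 * r powr (- \<alpha>)) *\<^sub>R (R *v
        cyl (k\<^sup>2 * M \<phi> powr (- \<alpha> / 2) * cos \<phi> / sin \<phi>) (k * M \<phi> powr ((1 - \<alpha>) / 2) / sin \<phi>)
          (M \<phi> powr (- \<alpha> / 2)) \<theta>)"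
      unfolding X V[OF r \<phi>] cyl by (simp add: matrix_vector_mult_scaleR mult.commute)
    also have "w\<^sub>1 * r powr (- \<alpha>) = ?c * (a\<^sub>0 powr (2 - \<alpha>) * r powr (- \<alpha>))"
    proof -
      have "a\<^sub>0 powr (\<alpha> - 2) * a\<^sub>0 powr (2 - \<alpha>) = 1" using a0 by (simp flip: powr_add)
      then show ?thesis by (metis mult.assoc mult.left_commute mult_1)
    qed
    finally show ?thesis unfolding ff by (simp add: True matrix_vector_mult_scaleR)
  qed
qed

text \<open>Spherical coordinates give the formula off the axis; both sides are continuous away from
  the origin, so it holds on the axis too.\<close>

lemma radial_field:
  fixes V :: "real^3 \<Rightarrow> real^3" and R :: "real^3^3"
  assumes cont: "continuous_on (- {0}) V" and R: "orthogonal_matrix R"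
    and V: "\<And>r \<phi> \<theta>. r > 0 \<Longrightarrow> \<phi> \<in> {0<..<pi} \<Longrightarrow>
      V (R *v (r *\<^sub>R sph \<phi> \<theta>)) = r powr (- \<alpha>) *\<^sub>R (R *v (c *\<^sub>R sph \<phi> \<theta>))"
    and Y: "Y \<noteq> 0"
  shows "V Y = (c * norm Y powr (- \<alpha> - 1)) *\<^sub>R Y"
proof -
  have RT: "R *v (transpose R *v X) = X" for X
    using R by (simp add: matrix_vector_mul_assoc orthogonal_matrix_def del: transpose_matrix_vector)
  have nR: "norm (R *v X) = norm X" for X
    using R orthogonal_transformation_matrix[of "(*v) R"] by (simp add: orthogonal_transformation_norm)
  define X where "X = transpose R *v Y"
  have YX: "Y = R *v X" by (simp only: X_def RT)
  have "V (R *v X) = (c * norm X powr (- \<alpha> - 1)) *\<^sub>R (R *v X)"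
  proof (rule eq_off_axis_imp_eq[where F = "\<lambda>X. V (R *v X)" and G = "\<lambda>X. (c * norm X powr (- \<alpha> - 1)) *\<^sub>R (R *v X)"])
    have R_cont: "continuous_on S ((*v) R)" for S
      by (intro linear_continuous_on matrix_vector_mul_bounded_linear)
    have "R *v X \<in> - {0}" if "X \<in> - {0}" for X
      using that nR[of X] by (metis Compl_iff norm_eq_zero singleton_iff)
    then have "(*v) R ` (- {0}) \<subseteq> - {0}" by (rule image_subsetI)
    from continuous_on_compose2[OF cont R_cont this]
    show "continuous_on (- {0}) (\<lambda>X. V (R *v X))" .
    show "continuous_on (- {0}) (\<lambda>X. (c * norm X powr (- \<alpha> - 1)) *\<^sub>R (R *v X))"
      by (intro continuous_intros R_cont) auto
    show "X \<noteq> 0" using Y YX by auto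
    fix X :: "real^3" assume "(X$1)\<^sup>2 + (X$2)\<^sup>2 > 0"
    then obtain r \<phi> \<theta> where r: "r > 0" and \<phi>: "\<phi> \<in> {0<..<pi}" and X: "X = r *\<^sub>R sph \<phi> \<theta>"
      by (rule spherical_coordinates)
    have nX: "norm X = r" using r by (simp add: X norm_sph)
    have e: "r powr (- \<alpha>) = r powr (- \<alpha> - 1) * r"
      using r by (simp add: powr_diff)
    show "V (R *v X) = (c * norm X powr (- \<alpha> - 1)) *\<^sub>R (R *v X)"
      unfolding nX unfolding X V[OF r \<phi>] e
      by (simp add: matrix_vector_mult_scaleR mult.commute mult.left_commute)
  qed
  then show ?thesis by (simp add: YX nR)
qed

theorem proposition5p3:
  fixes \<alpha> :: real and v :: "real^3 \<Rightarrow> real^3" and f p :: "real^3 \<Rightarrow> real" and R :: "real^3^3"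
  assumes "C1_solution \<alpha> v f p"
    and "nontrivial v f"
    and "rotation_matrix R" and "axisymmetric_in R v f p"
    and "p constant_on sphere 0 1"
  shows "geodesic \<alpha> v f \<and>
    ((\<exists>a\<^sub>0 b\<^sub>0. (\<forall>n\<in>sphere 0 1. \<alpha> * p n = 0) \<and> a\<^sub>0\<^sup>2 + b\<^sub>0\<^sup>2 = 1 \<and>
        is_family_member R \<alpha> a\<^sub>0 b\<^sub>0 (hom_velocity \<alpha> v f) \<and>
        (b\<^sub>0 \<noteq> 0 \<longrightarrow> \<alpha> \<le> -2) \<and>
        (b\<^sub>0 = 0 \<longrightarrow> \<alpha> \<le> -1 \<or> \<alpha> = 0)) \<or>
     (\<alpha> = 2 \<and> (\<forall>n\<in>sphere 0 1. v n = 0) \<and> f constant_on sphere 0 1 \<and>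
        (\<forall>n\<in>sphere 0 1. p n = - (f n)\<^sup>2 / 2)))"
proof -
  let ?V = "hom_velocity \<alpha> v f"
  obtain c where p: "\<And>n. n \<in> sphere 0 1 \<Longrightarrow> p n = c"
    using assms(5) by (auto simp: constant_on_def)
  have oR: "orthogonal_matrix R" using assms(3) by (simp add: rotation_matrix_def)
  \<comment> \<open>The acceleration is a multiple of \<open>X\<close>. The solution is therefore
    geodesic in both cases below: in the first the velocity is radial, in the second the multiple is
    zero.\<close>
  have diff: "?V differentiable (at X)"
    and conv: "convective ?V X = (2 * \<alpha> * c * norm X powr (- 2 * \<alpha> - 2)) *\<^sub>R X" if "X \<noteq> 0" for X
  proof -
    have "?V differentiable (at X)" "convective ?V X = - gradient (hom_pressure \<alpha> p) X"
      using assms(1) that by (auto simp: C1_solution_def stationary_Euler_on_def eq_neg_iff_add_eq_0)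
    then show "?V differentiable (at X)"
      "convective ?V X = (2 * \<alpha> * c * norm X powr (- 2 * \<alpha> - 2)) *\<^sub>R X"
      using gradient_hom_pressure_const[of p c X \<alpha>] p that by simp_all
  qed
  have cont: "continuous_on (- {0}) ?V"
    using diff by (intro differentiable_imp_continuous_on) (auto simp: differentiable_on_def intro: differentiable_at_withinI)
  obtain u b w u' b' w' where profile: "axisymmetric_profile \<alpha> (2 * \<alpha> * c) u b w u' b' w'"
    and V: "\<And>r \<phi> \<theta>. r > 0 \<Longrightarrow> \<phi> \<in> {0<..<pi} \<Longrightarrow>
      ?V (R *v (r *\<^sub>R sph \<phi> \<theta>)) = r powr (- \<alpha>) *\<^sub>R (R *v cyl (u \<phi>) (b \<phi>) (w \<phi>) \<theta>)"
    using rotated_profile[OF assms(1,3,4) p] by metis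
  interpret prof: axisymmetric_profile \<alpha> "2 * \<alpha> * c" u b w u' b' w' by (rule profile)
  show ?thesis
  proof (cases "prof.support = {}")
    case True
    then obtain c\<^sub>1 where c1: "(\<alpha> - 2) * c\<^sub>1 = 0" "\<alpha> * c\<^sub>1\<^sup>2 + 2 * \<alpha> * c = 0"
      and uw: "\<And>t. t \<in> {0<..<pi} \<Longrightarrow> u t = c\<^sub>1 * sin t \<and> b t = 0 \<and> w t = c\<^sub>1 * cos t"
      by (rule prof.radial_profile) (rule that)
    have VY: "?V Y = (c\<^sub>1 * norm Y powr (- \<alpha> - 1)) *\<^sub>R Y" if "Y \<noteq> 0" for Y
      by (rule radial_field[OF cont oR _ that]) (use V uw in \<open>simp add: cyl_radial\<close>)
    have vf: "f n = c\<^sub>1 \<and> v n = 0" if n: "n \<in> sphere 0 1" for n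
    proof -
      have 1: "norm n = 1" "v n \<bullet> n = 0" using n assms(1) by (auto simp: C1_solution_def)
      then have "n \<noteq> 0" by auto
      then have e: "v n + f n *\<^sub>R n = c\<^sub>1 *\<^sub>R n"
        using VY[of n] 1(1) by (simp add: hom_velocity_def sgn_div_norm)
      from arg_cong[OF this, of "\<lambda>x. x \<bullet> n"] have "f n = c\<^sub>1"
        using 1 by (simp add: inner_add_left dot_square_norm)
      then show ?thesis using e by simp
    qed
    have "c\<^sub>1 \<noteq> 0" using assms(2) vf by (auto simp: nontrivial_def)
    then have \<alpha>: "\<alpha> = 2" using c1 by simp
    have "c = - c\<^sub>1\<^sup>2 / 2" using c1(2) \<alpha> by simp
    moreover have "geodesic \<alpha> v f"
      unfolding geodesic_def by (auto simp: conv VY cross_mult_left cross_mult_right)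
    ultimately show ?thesis using \<alpha> vf p by (auto simp: constant_on_def)
  next
    case False
    then obtain w\<^sub>1 l\<^sub>1 where w1: "w\<^sub>1 \<noteq> 0" and \<kappa>: "2 * \<alpha> * c = 0" and l1: "l\<^sub>1 \<noteq> 0 \<Longrightarrow> \<alpha> \<le> -2"
      and pos: "\<And>t. \<lbrakk>t \<in> {0<..<pi}; (sin t)\<^sup>2 - (l\<^sub>1 / w\<^sub>1)\<^sup>2 * (cos t)\<^sup>2 > 0\<rbrakk> \<Longrightarrow>
      w t = w\<^sub>1 * ((sin t)\<^sup>2 - (l\<^sub>1 / w\<^sub>1)\<^sup>2 * (cos t)\<^sup>2) powr (- \<alpha> / 2) \<and>
      b t * sin t = l\<^sub>1 * ((sin t)\<^sup>2 - (l\<^sub>1 / w\<^sub>1)\<^sup>2 * (cos t)\<^sup>2) powr ((1 - \<alpha>) / 2) \<and>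
      u t * sin t = l\<^sub>1\<^sup>2 / w\<^sub>1 * ((sin t)\<^sup>2 - (l\<^sub>1 / w\<^sub>1)\<^sup>2 * (cos t)\<^sup>2) powr (- \<alpha> / 2) * cos t"
      and nonpos: "\<And>t. \<lbrakk>t \<in> {0<..<pi}; (sin t)\<^sup>2 - (l\<^sub>1 / w\<^sub>1)\<^sup>2 * (cos t)\<^sup>2 \<le> 0\<rbrakk> \<Longrightarrow>
        u t = 0 \<and> b t = 0 \<and> w t = 0"
      by (rule prof.global_profile) (rule that)
    \<comment> \<open>Up to sign \<open>k\<close> is the tangent of the polar angle at the edge of
      the band. The pair \<open>a\<^sub>0\<close>, \<open>- k * a\<^sub>0\<close> has ratio
      \<open>- k\<close> and is normalised to squares with sum 1.\<close>
    define k where "k = l\<^sub>1 / w\<^sub>1"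
    define a\<^sub>0 where "a\<^sub>0 = 1 / sqrt (1 + k\<^sup>2)"
    have a0: "a\<^sub>0 > 0" by (simp add: a\<^sub>0_def add_pos_nonneg)
    have k2: "1 + k\<^sup>2 > 0" by (simp add: add_pos_nonneg)
    have "a\<^sub>0\<^sup>2 + (- k * a\<^sub>0)\<^sup>2 = a\<^sub>0\<^sup>2 * (1 + k\<^sup>2)" by (simp add: power_mult_distrib algebra_simps)
    also have "\<dots> = 1" using k2 by (simp add: a\<^sub>0_def power_divide)
    finally have one: "a\<^sub>0\<^sup>2 + (- k * a\<^sub>0)\<^sup>2 = 1" .
    have "is_family_member R \<alpha> a\<^sub>0 (- k * a\<^sub>0) ?V"
      unfolding k_def by (rule family_member_of_profile[OF cont w1 V pos nonpos a0])
    moreover have "geodesic \<alpha> v f" unfolding geodesic_def using \<kappa> by (auto simp: conv)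
    moreover have "\<alpha> * p n = 0" if "n \<in> sphere 0 1" for n using p[OF that] \<kappa> by simp
    moreover have "- k * a\<^sub>0 \<noteq> 0 \<longrightarrow> \<alpha> \<le> -2" using l1 by (auto simp: k_def)
    moreover have "- k * a\<^sub>0 = 0 \<longrightarrow> \<alpha> \<le> -1 \<or> \<alpha> = 0"
    proof
      assume "- k * a\<^sub>0 = 0"
      then have l0: "l\<^sub>1 = 0" using a0 w1 by (simp add: k_def)
      have "\<alpha> = 0 \<or> \<alpha> \<le> -1"
      proof (rule swirl_free_exponent[OF _ oR w1])
        have "norm (R *v sph 0 0) = 1"
          using oR orthogonal_transformation_matrix[of "(*v) R"] by (simp add: orthogonal_transformation_norm norm_sph)
        then show "?V differentiable (at (R *v sph 0 0))" by (intro diff) auto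
        fix s :: real assume s: "s \<in> {0<..<pi}"
        have ss: "sin s > 0" using s by (simp add: sin_gt_zero)
        have "(sin s)\<^sup>2 powr (- \<alpha> / 2) = sin s powr (- \<alpha>)"
          using ss by (simp add: powr_powr flip: powr_numeral)
        \<comment> \<open>For \<open>l\<^sub>1 = 0\<close> the band function is the square of the
          sine, positive on the whole open meridian.\<close>
        then have "w s = w\<^sub>1 * sin s powr (- \<alpha>)" using pos[OF s] l0 ss by simp
        then show "?V (R *v sph s 0) = R *v cyl (u s) (b s) (w\<^sub>1 * sin s powr (- \<alpha>)) 0"
          using V[of 1 s 0] s by simp
      qed
      then show "\<alpha> \<le> -1 \<or> \<alpha> = 0" by blast
    qed
    ultimately show ?thesis using one by blast
  qed
qed

end
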